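(* Let $\mathfrak{g}$ be a complex simple Lie algebra, and let $V$ be a minuscule $\mathfrak{g}$-representation with minuscule weight $\lambda$ and minuscule heap $P_\lambda$. Let $\alpha$ be a simple root of $\mathfrak{g}$ with corresponding fundamental weight $\omega$, and let $P_\lambda^\alpha \subset P_\lambda$ be the set of elements of $P_\lambda$ labeled by $\alpha$. Let $f^\alpha \colon J(P_\lambda) \to \mathbb{R}$ be defined by $I \mapsto |I \cap P_\lambda^\alpha|$. Then, with respect to the Fon-Der-Flaass action $\Psi$ on $J(P_\lambda)$, $f^\alpha$ is $c$-mesic with $$c = 2\,\frac{(\lambda,\omega)}{(\alpha,\alpha)}.$$
   Context: **Lie-theoretic setting.** $\mathfrak{g}$ is a complex simple Lie algebra with a fixed Cartan subalgebra $\mathfrak{h}$, root system $R$, and real span $\mathfrak{h}_{\mathbb{R}}^*$ of $R$ in $\mathfrak{h}^*$; $(\cdot,\cdot)$ is the inner product on $\mathfrak{h}_{\mathbb{R}}^*$ induced by the Killing form. For $\alpha\in R$, $\alpha^\vee := 2\alpha/(\alpha,\alpha)$. Fix simple roots $\alpha_1,\dots,\alpha_t$. The weight lattice is $\Lambda=\{\mu\in\mathfrak{h}_{\mathbb{R}}^* : (\mu,\alpha_i^\vee)\in\mathbb{Z}\ \forall i\}$, and $\mu\in\Lambda$ is dominant if $(\mu,\alpha_i^\vee)\ge 0$ for all $i$. The fundamental weights $\omega_1,\dots,\omega_t$ are defined by $(\omega_i,\alpha_j^\vee)=\delta_{ij}$; $\omega_i$ is the fundamental weight corresponding to $\alpha_i$.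 $W$ is the Weyl group, generated by the simple reflections $s_i(\mu)=\mu-(\mu,\alpha_i^\vee)\alpha_i$, with longest element $w_0$. **Minuscule representations.** For dominant $\lambda$, $V^\lambda$ is the irreducible representation of highest weight $\lambda$ and $\Lambda_\lambda$ is its set of weights. An irreducible finite-dimensional representation $V\cong V^\lambda$ is minuscule, with minuscule weight $\lambda$, if $W$ acts transitively on $\Lambda_\lambda$. In that case $\Lambda_\lambda$ is partially ordered by the order opposite to the root order: covering relations are $\mu\lessdot\mu-\alpha_i$ (with $\mu,\mu-\alpha_i\in\Lambda_\lambda$), so $\lambda$ is the unique minimal element and $w_0\lambda$ the unique maximal element. It is a known fact that $\Lambda_\lambda$ is a distributive lattice; the minuscule poset for $V$ is its poset of join-irreducible elements. **Minuscule heap.** An element $w\in W$ is $\lambda$-minuscule if it has a reduced word $w=s_{i_\ell}\cdots s_{i_1}$ such that $\lambda\lessdot s_{i_1}\lambda\lessdot\cdots\lessdot (s_{i_\ell}\cdots s_{i_1})\lambda=w\lambda$ is a saturated chain in $\Lambda_\lambda$. There is a unique $\lambda$-minuscule $w$ with $w\lambda=w_0\lambda$. Take any reduced word $w=s_{i_\ell}\cdots s_{i_1}$ of it. The minuscule heap $P_\lambda$ is the labeled set $\{1,\dots,\ell\}$, where element $j$ is labeled by $i_j$ (equivalently, by the simple root $\alpha_{i_j}$), with the partial order that is the transitive closure of the relations $j<j'$ for all $1\le j<j'\le\ell$ such that $s_{i_j}$ and $s_{i_{j'}}$ do not commute. Up to isomorphism of labeled posets this does not depend on the reduced word, and as a poset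 $P_\lambda$ is isomorphic to the minuscule poset for $V$. **Order ideals and the Fon-Der-Flaass action.** For a finite poset $P$, $J(P)$ is the set of order ideals (down-closed subsets) of $P$. The Fon-Der-Flaass action $\Psi\colon J(P)\to J(P)$ is the bijection sending $I$ to the order ideal generated by the minimal elements of $P\setminus I$. **Homomesy.** Let $\mathcal{S}$ be a finite set and $\tau\colon\mathcal{S}\to\mathcal{S}$ a bijection of order $m$ (the least positive integer with $\tau^m=\mathrm{id}$). A function $f\colon\mathcal{S}\to\mathbb{R}$ is $c$-mesic with respect to $\tau$ if $\frac1m\sum_{k=0}^{m-1}f(\tau^k(x))=c$ for all $x\in\mathcal{S}$. *)

theory Defs
  imports "HOL-Analysis.Analysis" "HOL-Library.Function_Algebras"
begin

section \<open>Homomesy and the Fon-Der-Flaass action\<close>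

definition map_order :: "'a set \<Rightarrow> ('a \<Rightarrow> 'a) \<Rightarrow> nat" where
  "map_order S \<tau> = (LEAST m. 0 < m \<and> (\<forall>x\<in>S. (\<tau> ^^ m) x = x))"

definition mesic :: "'a set \<Rightarrow> ('a \<Rightarrow> 'a) \<Rightarrow> ('a \<Rightarrow> real) \<Rightarrow> real \<Rightarrow> bool" where
  "mesic S \<tau> f c \<longleftrightarrow> finite S \<and> bij_betw \<tau> S S \<and>
     (\<forall>x\<in>S. (\<Sum>k<map_order S \<tau>. f ((\<tau> ^^ k) x)) / real (map_order S \<tau>) = c)"

text \<open>A poset is a carrier \<open>P\<close> with a relation \<open>r\<close>, where \<open>(x, y) \<in> r\<close> means \<open>x \<le> y\<close>.\<close>

definition order_ideals :: "'a set \<Rightarrow> ('a \<times> 'a) set \<Rightarrow> 'a set set" where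
  "order_ideals P r = {I. I \<subseteq> P \<and> (\<forall>y\<in>I. \<forall>x\<in>P. (x, y) \<in> r \<longrightarrow> x \<in> I)}"

definition ideal_generated :: "'a set \<Rightarrow> ('a \<times> 'a) set \<Rightarrow> 'a set \<Rightarrow> 'a set" where
  "ideal_generated P r A = {x \<in> P. \<exists>a\<in>A. (x, a) \<in> r}"

definition minimal_elements :: "('a \<times> 'a) set \<Rightarrow> 'a set \<Rightarrow> 'a set" where
  "minimal_elements r A = {x \<in> A. \<forall>y\<in>A. (y, x) \<in> r \<longrightarrow> y = x}"

definition fon_der_flaass :: "'a set \<Rightarrow> ('a \<times> 'a) set \<Rightarrow> 'a set \<Rightarrow> 'a set" where
  "fon_der_flaass P r I = ideal_generated P r (minimal_elements r (P - I))"


section \<open>Real scaling of complex-valued functionals\<close>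

definition rscale :: "real \<Rightarrow> ('a \<Rightarrow> complex) \<Rightarrow> 'a \<Rightarrow> complex" where
  "rscale r \<phi> = (\<lambda>x. complex_of_real r * \<phi> x)"

interpretation functional: vector_space "rscale :: real \<Rightarrow> ('a \<Rightarrow> complex) \<Rightarrow> 'a \<Rightarrow> complex"
  by unfold_locales (auto simp: rscale_def algebra_simps fun_eq_iff)


section \<open>Complex simple Lie algebras\<close>

text \<open>
  The Lie algebra is the whole type \<open>'g\<close>. The parameter \<open>Basis\<close> is an arbitrary vector space basis;
  it witnesses finite dimension and serves to write down traces, which do not depend on it.
\<close>

locale complex_lie_algebra =
  finite_dimensional_vector_space scale Basis
  for scale :: "complex \<Rightarrow> 'g::ab_group_add \<Rightarrow> 'g" and Basis :: "'g set" +
  fixes bracket :: "'g \<Rightarrow> 'g \<Rightarrow> 'g"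
  assumes linear_bracket_left: "Vector_Spaces.linear scale scale (\<lambda>x. bracket x y)"
    and linear_bracket_right: "Vector_Spaces.linear scale scale (bracket x)"
    and bracket_self: "bracket x x = 0"
    and jacobi: "bracket x (bracket y z) + bracket y (bracket z x) + bracket z (bracket x y) = 0"
begin

definition endo_trace :: "('g \<Rightarrow> 'g) \<Rightarrow> complex" where
  "endo_trace f = (\<Sum>b\<in>Basis. representation Basis (f b) b)"

definition killing :: "'g \<Rightarrow> 'g \<Rightarrow> complex" where
  "killing x y = endo_trace (\<lambda>z. bracket x (bracket y z))"

definition lie_ideal :: "'g set \<Rightarrow> bool" where
  "lie_ideal I \<longleftrightarrow> subspace I \<and> (\<forall>x. \<forall>y\<in>I. bracket x y \<in> I)"

definition abelian_subalgebra :: "'g set \<Rightarrow> bool" where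
  "abelian_subalgebra a \<longleftrightarrow> subspace a \<and> (\<forall>x\<in>a. \<forall>y\<in>a. bracket x y = 0)"

definition semisimple_endo :: "('g \<Rightarrow> 'g) \<Rightarrow> bool" where
  "semisimple_endo f \<longleftrightarrow> span {x. \<exists>c. f x = scale c x} = UNIV"

text \<open>
  The usual definition for a complex semisimple Lie algebra (e.g. Helgason): a maximal abelian
  subalgebra all of whose elements are ad-semisimple, i.e. ad-diagonalizable.
\<close>

definition cartan_subalgebra :: "'g set \<Rightarrow> bool" where
  "cartan_subalgebra h \<longleftrightarrow> abelian_subalgebra h \<and>
     (\<forall>a. abelian_subalgebra a \<and> h \<subseteq> a \<longrightarrow> a = h) \<and>
     (\<forall>H\<in>h. semisimple_endo (bracket H))"

end

locale complex_simple_lie_algebra = complex_lie_algebra +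
  assumes nonabelian: "\<exists>x y. bracket x y \<noteq> 0"
    and simple: "lie_ideal I \<Longrightarrow> I = {0} \<or> I = UNIV"


section \<open>Roots and the induced inner product\<close>

locale simple_lie_algebra_with_cartan = complex_simple_lie_algebra +
  fixes h :: "'a set"
  assumes cartan: "cartan_subalgebra h"
begin

text \<open>
  A linear functional on \<open>h\<close> is represented by its extension by 0 to all of the Lie algebra (as a
  function, not as a linear map), so that equality of functionals is equality of functions.
\<close>

definition dual :: "('a \<Rightarrow> complex) set" where
  "dual = {\<phi>. (\<forall>x\<in>h. \<forall>y\<in>h. \<phi> (x + y) = \<phi> x + \<phi> y) \<and>
              (\<forall>c. \<forall>x\<in>h. \<phi> (scale c x) = c * \<phi> x) \<and>
              (\<forall>x. x \<notin> h \<longrightarrow> \<phi> x = 0)}"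

definition root_space :: "('a \<Rightarrow> complex) \<Rightarrow> 'a set" where
  "root_space \<alpha> = {x. \<forall>H\<in>h. bracket H x = scale (\<alpha> H) x}"

definition roots :: "('a \<Rightarrow> complex) set" where
  "roots = {\<alpha> \<in> dual. \<alpha> \<noteq> 0 \<and> root_space \<alpha> \<noteq> {0}}"

definition real_dual :: "('a \<Rightarrow> complex) set" where
  "real_dual = functional.span roots"

definition killing_dual :: "('a \<Rightarrow> complex) \<Rightarrow> 'a" where
  "killing_dual \<phi> = (THE t. t \<in> h \<and> (\<forall>H\<in>h. killing t H = \<phi> H))"

text \<open>On \<open>real_dual\<close> the form transported from the Killing form is real-valued, so taking the real
  part merely changes the type.\<close>

definition inner_dual :: "('a \<Rightarrow> complex) \<Rightarrow> ('a \<Rightarrow> complex) \<Rightarrow> real" where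
  "inner_dual \<phi> \<psi> = Re (killing (killing_dual \<phi>) (killing_dual \<psi>))"

definition coroot :: "('a \<Rightarrow> complex) \<Rightarrow> 'a \<Rightarrow> complex" where
  "coroot \<alpha> = rscale (2 / inner_dual \<alpha> \<alpha>) \<alpha>"

text \<open>Reflections are maps of \<open>real_dual\<close>, extended by the identity outside it, so that equality of
  Weyl group elements is equality of functions.\<close>

definition reflection :: "('a \<Rightarrow> complex) \<Rightarrow> ('a \<Rightarrow> complex) \<Rightarrow> 'a \<Rightarrow> complex" where
  "reflection \<alpha> \<mu> =
     (if \<mu> \<in> real_dual then \<mu> - rscale (inner_dual \<mu> (coroot \<alpha>)) \<alpha> else \<mu>)"

definition positive_roots :: "('a \<Rightarrow> complex) set \<Rightarrow> ('a \<Rightarrow> complex) set" where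
  "positive_roots \<Delta> = {\<beta> \<in> roots. \<exists>k :: _ \<Rightarrow> nat. \<beta> = (\<Sum>\<alpha>\<in>\<Delta>. rscale (real (k \<alpha>)) \<alpha>)}"

definition simple_system :: "('a \<Rightarrow> complex) set \<Rightarrow> bool" where
  "simple_system \<Delta> \<longleftrightarrow> \<Delta> \<subseteq> roots \<and> functional.independent \<Delta> \<and>
     functional.span \<Delta> = real_dual \<and>
     (\<forall>\<beta>\<in>roots. \<beta> \<in> positive_roots \<Delta> \<or> - \<beta> \<in> positive_roots \<Delta>)"

end


section \<open>Weights, the Weyl group and heaps\<close>

text \<open>A word \<open>ws\<close> of labels yields elements \<open>0, \<dots>, length ws - 1\<close>, where \<open>j\<close> has label \<open>ws ! j\<close>.\<close>

definition heap :: "'b list \<Rightarrow> nat set" where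
  "heap ws = {..<length ws}"

definition heap_label_class :: "'b list \<Rightarrow> 'b \<Rightarrow> nat set" where
  "heap_label_class ws \<alpha> = {j \<in> heap ws. ws ! j = \<alpha>}"

locale based_simple_lie_algebra = simple_lie_algebra_with_cartan +
  fixes \<Delta> :: "('a \<Rightarrow> complex) set"
  assumes simple_system: "simple_system \<Delta>"
begin

definition weight_lattice :: "('a \<Rightarrow> complex) set" where
  "weight_lattice = {\<mu> \<in> real_dual. \<forall>\<alpha>\<in>\<Delta>. inner_dual \<mu> (coroot \<alpha>) \<in> \<int>}"

definition dominant :: "('a \<Rightarrow> complex) \<Rightarrow> bool" where
  "dominant \<mu> \<longleftrightarrow> \<mu> \<in> weight_lattice \<and> (\<forall>\<alpha>\<in>\<Delta>. inner_dual \<mu> (coroot \<alpha>) \<ge> 0)"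

definition fundamental_weight :: "('a \<Rightarrow> complex) \<Rightarrow> ('a \<Rightarrow> complex) \<Rightarrow> bool" where
  "fundamental_weight \<alpha> \<omega> \<longleftrightarrow> \<omega> \<in> real_dual \<and>
     (\<forall>\<beta>\<in>\<Delta>. inner_dual \<omega> (coroot \<beta>) = (if \<beta> = \<alpha> then 1 else 0))"

text \<open>
  A word is a list \<open>[\<beta>\<^sub>1, \<dots>, \<beta>\<^sub>l]\<close> of simple roots; \<open>fold reflection\<close> applies its head first, so the
  word stands for the product \<open>s\<^sub>l \<cdots> s\<^sub>1\<close>, whose rightmost factor is the reflection in \<open>\<beta>\<^sub>1\<close>. As simple
  reflections are involutions, words exhaust the group they generate.
\<close>

definition weyl_group :: "(('a \<Rightarrow> complex) \<Rightarrow> 'a \<Rightarrow> complex) set" where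
  "weyl_group = {fold reflection ws | ws. set ws \<subseteq> \<Delta>}"

definition weyl_length :: "(('a \<Rightarrow> complex) \<Rightarrow> 'a \<Rightarrow> complex) \<Rightarrow> nat" where
  "weyl_length w = (LEAST n. \<exists>ws. set ws \<subseteq> \<Delta> \<and> length ws = n \<and> fold reflection ws = w)"

definition reduced_word :: "('a \<Rightarrow> complex) list \<Rightarrow> (('a \<Rightarrow> complex) \<Rightarrow> 'a \<Rightarrow> complex) \<Rightarrow> bool" where
  "reduced_word ws w \<longleftrightarrow>
     set ws \<subseteq> \<Delta> \<and> fold reflection ws = w \<and> length ws = weyl_length w"

definition longest_element :: "(('a \<Rightarrow> complex) \<Rightarrow> 'a \<Rightarrow> complex) \<Rightarrow> bool" where
  "longest_element w0 \<longleftrightarrow> w0 \<in> weyl_group \<and> (\<forall>w\<in>weyl_group. weyl_length w \<le> weyl_length w0)"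

definition heap_order :: "('a \<Rightarrow> complex) list \<Rightarrow> (nat \<times> nat) set" where
  "heap_order ws = Restr
     ({(j, k). j < k \<and> k < length ws \<and>
        reflection (ws ! j) \<circ> reflection (ws ! k) \<noteq> reflection (ws ! k) \<circ> reflection (ws ! j)}\<^sup>*)
     (heap ws)"

end


section \<open>Representations\<close>

text \<open>The representation space is the whole type \<open>'v\<close>; \<open>BasisV\<close> only witnesses finite dimension.\<close>

locale lie_representation = based_simple_lie_algebra +
  V: finite_dimensional_vector_space scaleV BasisV
  for scaleV :: "complex \<Rightarrow> 'v::ab_group_add \<Rightarrow> 'v" and BasisV :: "'v set" +
  fixes \<rho> :: "'a \<Rightarrow> 'v \<Rightarrow> 'v"
  assumes linear_rep_left: "Vector_Spaces.linear scale scaleV (\<lambda>x. \<rho> x v)"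
    and linear_rep_right: "Vector_Spaces.linear scaleV scaleV (\<rho> x)"
    and rep_bracket: "\<rho> (bracket x y) v = \<rho> x (\<rho> y v) - \<rho> y (\<rho> x v)"
begin

definition irreducible_rep :: bool where
  "irreducible_rep \<longleftrightarrow> (\<exists>v::'v. v \<noteq> 0) \<and>
     (\<forall>U. V.subspace U \<and> (\<forall>x. \<forall>v\<in>U. \<rho> x v \<in> U) \<longrightarrow> U = {0} \<or> U = UNIV)"

definition weight_space :: "('a \<Rightarrow> complex) \<Rightarrow> 'v set" where
  "weight_space \<mu> = {v. \<forall>H\<in>h. \<rho> H v = scaleV (\<mu> H) v}"

definition weights :: "('a \<Rightarrow> complex) set" where
  "weights = {\<mu> \<in> dual. weight_space \<mu> \<noteq> {0}}"

definition highest_weight :: "('a \<Rightarrow> complex) \<Rightarrow> bool" where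
  "highest_weight lam \<longleftrightarrow> lam \<in> weights \<and>
     (\<exists>v \<in> weight_space lam. v \<noteq> 0 \<and>
        (\<forall>\<beta> \<in> positive_roots \<Delta>. \<forall>x \<in> root_space \<beta>. \<rho> x v = 0))"

definition minuscule :: "('a \<Rightarrow> complex) \<Rightarrow> bool" where
  "minuscule lam \<longleftrightarrow> irreducible_rep \<and> dominant lam \<and> highest_weight lam \<and>
     (\<forall>\<mu>\<in>weights. \<forall>\<nu>\<in>weights. \<exists>w\<in>weyl_group. w \<mu> = \<nu>)"

text \<open>Covering relations of the order on the weights opposite to the root order.\<close>

definition weight_covers :: "('a \<Rightarrow> complex) \<Rightarrow> ('a \<Rightarrow> complex) \<Rightarrow> bool" where
  "weight_covers \<mu> \<nu> \<longleftrightarrow> \<mu> \<in> weights \<and> \<nu> \<in> weights \<and> (\<exists>\<alpha>\<in>\<Delta>. \<nu> = \<mu> - \<alpha>)"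

definition minuscule_element ::
  "('a \<Rightarrow> complex) \<Rightarrow> (('a \<Rightarrow> complex) \<Rightarrow> 'a \<Rightarrow> complex) \<Rightarrow> bool" where
  "minuscule_element lam w \<longleftrightarrow> w \<in> weyl_group \<and> (\<exists>ws. reduced_word ws w \<and>
     (\<forall>j<length ws. weight_covers (fold reflection (take j ws) lam)
                                  (fold reflection (take (Suc j) ws) lam)))"

end

end

theory Submission
  imports Defs "HOL-Combinatorics.Cycles"
begin

text \<open>
  To an order ideal \<open>I\<close> of the heap attach the weight \<open>\<mu>(I) = \<lambda> - \<Sum>\<close> of the labels of \<open>I\<close>, so that
  \<open>(\<lambda> - \<mu>(I), \<omega>) = f\<^sup>\<alpha>(I) (\<alpha>, \<alpha>) / 2\<close>. For every simple root \<open>\<beta>\<close> the integer \<open>(\<mu>(I), \<beta>\<^sup>\<or>)\<close> is \<open>1\<close> if an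
  element labelled \<open>\<beta>\<close> is minimal in the complement of \<open>I\<close>, minus \<open>1\<close> if an element labelled \<open>\<beta>\<close> is
  maximal in \<open>I\<close>. The maximal elements of \<open>\<Psi> I\<close> are the minimal elements of the complement of \<open>I\<close>, so
  these differences telescope along \<open>\<Psi>\<close>-orbits. Hence the weights of an orbit sum to something
  orthogonal to all simple roots, the average of \<open>(\<mu>(I), \<omega>)\<close> is \<open>0\<close>, and the average of \<open>f\<^sup>\<alpha>\<close> is
  \<open>2 (\<lambda>, \<omega>) / (\<alpha>, \<alpha>)\<close>. The representation enters only through the saturated chain of weights; as the
  inversions of a Weyl group element do not depend on a reduced word, every reduced word yields
  such a chain. The Lie algebra enters through its root system; the Killing form is nondegenerate
  because otherwise it would vanish; as an \<open>sl\<^sub>2\<close>-triple yields an element \<open>H\<close> with \<open>K(H, H) > 0\<close>, all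
  \<open>[g\<^sub>\<alpha>, g\<^sub>-\<^sub>\<alpha>]\<close> would then vanish and the root spaces would span a proper nonzero ideal.
\<close>

section \<open>Rowmotion on order ideals\<close>

text \<open>The pairing with a coroot is known only along prefixes of the word, and an order ideal
  is in general not a prefix. Rather than re-sorting the word for each ideal, one simple root
  \<beta> is treated at a time. Along the word the pairing with \<beta> drops from 1 to -1 at each
  letter \<beta> and climbs by at least 1 at each other letter that does not commute with \<beta>.
  So the stretch between two consecutive letters \<beta> climbs by exactly 2; dominance of \<lambda>
  limits the climb before the first \<beta> to 1, and antidominance of the final weight limits the
  climb after the last one to 1. As far as \<beta> can see, an ideal is a prefix ending with a
  letter \<beta> (or empty) together with part of the stretch that follows. This is why only the
  values -1, 0, 1 occur, and why each end of the chain needs its own sign condition.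

  The telescoping takes the form of a coboundary: f = c + g o \<Psi> - g with an explicit potential
  g, so that neither orbit lengths nor the order of \<Psi> have to be known.\<close>

lemma bij_betw_funpow_eq_id:
  assumes "finite S" and bij: "bij_betw \<tau> S S"
  shows "\<exists>m>0. \<forall>x\<in>S. (\<tau> ^^ m) x = x"
proof -
  \<comment> \<open>Extending \<tau> by the identity makes it a permutation of the whole type, and a
    permutation with finite support has finite order.\<close>
  define p where "p x = (if x \<in> S then \<tau> x else x)" for x
  have "p permutes S"
  proof (rule bij_imp_permutes)
    show "bij_betw p S S" using bij by (auto simp: p_def cong: bij_betw_cong)
  qed (auto simp: p_def)
  hence "permutation p" using \<open>finite S\<close> by (auto simp: permutation_permutes)
  then obtain n where n: "p ^^ n = id" "n > 0" by (rule permutation_is_nilpotent)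
  have "(p ^^ k) x = (\<tau> ^^ k) x \<and> (\<tau> ^^ k) x \<in> S" if "x \<in> S" for k x
    by (induction k) (use that bij in \<open>auto simp: p_def bij_betw_def\<close>)
  from this[of _ n] n show ?thesis by (intro exI[of _ n]) simp
qed

lemma map_order_props:
  assumes "finite S" and "bij_betw \<tau> S S"
  shows "map_order S \<tau> > 0" and "x \<in> S \<Longrightarrow> (\<tau> ^^ map_order S \<tau>) x = x"
  using LeastI_ex[OF bij_betw_funpow_eq_id[OF assms]] unfolding map_order_def by auto

text \<open>The deviation from \<open>c\<close> is a coboundary: over one full period the sum of
  \<open>g (\<tau> x) - g x\<close> collapses to a difference of \<open>g\<close> at the same
  point.\<close>

lemma mesicI:
  assumes fin: "finite S" and bij: "bij_betw \<tau> S S"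
    and f: "\<And>x. x \<in> S \<Longrightarrow> f x = c + g (\<tau> x) - g x"
  shows "mesic S \<tau> f c"
proof -
  have "(\<Sum>k<map_order S \<tau>. f ((\<tau> ^^ k) x)) = real (map_order S \<tau>) * c" if x: "x \<in> S" for x
  proof -
    have S: "(\<tau> ^^ k) x \<in> S" for k
      by (induction k) (use x bij in \<open>auto simp: bij_betw_def\<close>)
    have "(\<Sum>k<map_order S \<tau>. f ((\<tau> ^^ k) x))
        = (\<Sum>k<map_order S \<tau>. c + (g ((\<tau> ^^ Suc k) x) - g ((\<tau> ^^ k) x)))"
      by (intro sum.cong) (simp_all add: f[OF S])
    also have "\<dots> = real (map_order S \<tau>) * c + (g ((\<tau> ^^ map_order S \<tau>) x) - g ((\<tau> ^^ 0) x))"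
      by (subst sum_lessThan_telescope[symmetric]) (simp add: sum.distrib)
    finally show ?thesis using map_order_props(2)[OF fin bij x] by simp
  qed
  with map_order_props(1)[OF fin bij] fin bij show ?thesis by (simp add: mesic_def)
qed

definition maximal_elements :: "('a \<times> 'a) set \<Rightarrow> 'a set \<Rightarrow> 'a set" where
  "maximal_elements r A = {x \<in> A. \<forall>y\<in>A. (x, y) \<in> r \<longrightarrow> y = x}"

lemma ex_minimal_below:
  assumes "finite A" "trans r" "antisym r" "refl_on P r" "A \<subseteq> P" "x \<in> A"
  shows "\<exists>m\<in>minimal_elements r A. (m, x) \<in> r"
  using assms
proof (induction "card {y\<in>A. (y, x) \<in> r}" arbitrary: x rule: less_induct)
  case less
  show ?case
  proof (cases "x \<in> minimal_elements r A")
    case True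
    thus ?thesis using less.prems by (auto simp: refl_on_def)
  next
    case False
    then obtain y where y: "y \<in> A" "(y, x) \<in> r" "y \<noteq> x"
      using less.prems by (auto simp: minimal_elements_def)
    have "{z\<in>A. (z, y) \<in> r} \<subset> {z\<in>A. (z, x) \<in> r}"
    proof
      show "{z\<in>A. (z, y) \<in> r} \<subseteq> {z\<in>A. (z, x) \<in> r}"
        using y \<open>trans r\<close> by (auto dest: transD)
      have "x \<notin> {z\<in>A. (z, y) \<in> r}" "x \<in> {z\<in>A. (z, x) \<in> r}"
        using y less.prems by (auto simp: refl_on_def dest: antisymD)
      thus "{z\<in>A. (z, y) \<in> r} \<noteq> {z\<in>A. (z, x) \<in> r}" by blast
    qed
    hence "card {z\<in>A. (z, y) \<in> r} < card {z\<in>A. (z, x) \<in> r}"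
      using less.prems by (intro psubset_card_mono) auto
    from less.hyps[OF this] y less.prems obtain m where "m \<in> minimal_elements r A" "(m, y) \<in> r"
      by blast
    thus ?thesis using y \<open>trans r\<close> by (auto dest: transD)
  qed
qed

lemma fon_der_flaass_in_order_ideals:
  "trans r \<Longrightarrow> fon_der_flaass P r I \<in> order_ideals P r"
  unfolding fon_der_flaass_def order_ideals_def ideal_generated_def by (blast dest: transD)

text \<open>Minimal elements of a set form an antichain, and an antichain is recovered as the
  maximal elements of the ideal that it generates.\<close>

lemma maximal_elements_fon_der_flaass:
  assumes "trans r" "antisym r" "refl_on P r" "I \<in> order_ideals P r"
  shows "maximal_elements r (fon_der_flaass P r I) = minimal_elements r (P - I)"
proof -
  let ?M = "minimal_elements r (P - I)"
  have anti: "a = b" if "a \<in> ?M" "b \<in> ?M" "(a, b) \<in> r" for a b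
    using that by (auto simp: minimal_elements_def)
  have sub: "?M \<subseteq> fon_der_flaass P r I"
    using assms by (auto simp: fon_der_flaass_def ideal_generated_def minimal_elements_def refl_on_def)
  show ?thesis
  proof (intro equalityI subsetI)
    fix x assume x: "x \<in> maximal_elements r (fon_der_flaass P r I)"
    then obtain a where "a \<in> ?M" "(x, a) \<in> r"
      by (auto simp: maximal_elements_def fon_der_flaass_def ideal_generated_def)
    with x sub show "x \<in> ?M" by (auto simp: maximal_elements_def)
  next
    fix x assume x: "x \<in> ?M"
    have "y = x" if "y \<in> fon_der_flaass P r I" "(x, y) \<in> r" for y
    proof -
      from that obtain a where a: "a \<in> ?M" "(y, a) \<in> r"
        by (auto simp: fon_der_flaass_def ideal_generated_def)
      with that \<open>trans r\<close> have "(x, a) \<in> r" by (blast dest: transD)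
      with anti x a have "x = a" by blast
      with a that \<open>antisym r\<close> show ?thesis by (blast dest: antisymD)
    qed
    with x sub show "x \<in> maximal_elements r (fon_der_flaass P r I)"
      by (auto simp: maximal_elements_def)
  qed
qed

text \<open>The image of \<open>I\<close> determines, through its maximal elements, the minimal
  elements of the complement of \<open>I\<close>. These determine \<open>I\<close>, because in a
  finite poset everything outside \<open>I\<close> lies above one of them. Injectivity on a finite
  set then suffices.\<close>

lemma bij_betw_fon_der_flaass:
  assumes fin: "finite P" and r: "trans r" "antisym r" "refl_on P r"
  shows "bij_betw (fon_der_flaass P r) (order_ideals P r) (order_ideals P r)"
proof -
  have "order_ideals P r \<subseteq> Pow P" by (auto simp: order_ideals_def)
  hence finJ: "finite (order_ideals P r)" using fin by (auto intro: finite_subset)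
  have "inj_on (fon_der_flaass P r) (order_ideals P r)"
  proof (rule inj_onI)
    fix I I' assume I: "I \<in> order_ideals P r" "I' \<in> order_ideals P r"
      and eq: "fon_der_flaass P r I = fon_der_flaass P r I'"
    hence min: "minimal_elements r (P - I) = minimal_elements r (P - I')"
      using maximal_elements_fon_der_flaass[OF r] by metis
    have "x \<in> B" if AB: "A \<in> order_ideals P r" "B \<in> order_ideals P r"
      "minimal_elements r (P - A) = minimal_elements r (P - B)" "x \<in> A" for A B x
    proof (rule ccontr)
      assume "x \<notin> B"
      with AB have "x \<in> P - B" by (auto simp: order_ideals_def)
      from ex_minimal_below[OF _ r _ this] fin
      obtain m where "m \<in> minimal_elements r (P - B)" "(m, x) \<in> r" by blast
      moreover from this AB(3) have "m \<in> minimal_elements r (P - A)" by simp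
      ultimately show False using AB by (auto simp: order_ideals_def minimal_elements_def)
    qed
    with I min show "I = I'" by blast
  qed
  moreover have "fon_der_flaass P r ` order_ideals P r \<subseteq> order_ideals P r"
    using fon_der_flaass_in_order_ideals[OF r(1)] by blast
  ultimately show ?thesis using finJ by (simp add: bij_betw_def endo_inj_surj)
qed

section \<open>Pairing a coroot with the weight of an ideal\<close>

lemma sum_int_le_0_iff:
  fixes d :: "nat \<Rightarrow> int"
  assumes "finite A" "\<And>j. j \<in> A \<Longrightarrow> d j \<le> 0"
  shows "sum d A = 0 \<longleftrightarrow> (\<forall>j\<in>A. d j = 0)"
  using sum_nonneg_eq_0_iff[of A "\<lambda>j. - d j"] assms by (simp add: sum_negf)

text \<open>For a simple root \<open>\<beta>\<close>, \<open>d j\<close> is the pairing of the \<open>j\<close>-th letter of the word with \<open>\<beta>\<^sup>\<or>\<close>, so that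
  \<open>d j = 2\<close> marks the letters equal to \<open>\<beta>\<close> and \<open>d j < 0\<close> the letters which do not commute with \<open>\<beta>\<close>;
  \<open>L\<close> is the pairing of the highest weight with \<open>\<beta>\<^sup>\<or>\<close>.\<close>

lemma ideal_pairing_eq:
  fixes d :: "nat \<Rightarrow> int"
  assumes L: "L \<ge> 0"
    and d: "\<And>j. j < l \<Longrightarrow> d j = 2 \<or> d j \<le> 0"
    and one: "\<And>k. k < l \<Longrightarrow> d k = 2 \<Longrightarrow> L - sum d {..<k} = 1"
    and last: "L - sum d {..<l} \<le> 0"
    and I: "I \<subseteq> {..<l}"
    and ideal: "\<And>i j. i < j \<Longrightarrow> j \<in> I \<Longrightarrow> d i = 2 \<and> d j < 0 \<or> d i < 0 \<and> d j = 2 \<Longrightarrow> i \<in> I"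
  shows "L - sum d I = of_bool (\<exists>j<l. d j = 2 \<and> j \<notin> I \<and> (\<forall>i<j. d i < 0 \<longrightarrow> i \<in> I))
           - of_bool (\<exists>j\<in>I. d j = 2 \<and> (\<forall>i\<in>I. j < i \<longrightarrow> d i \<ge> 0))"
proof -
  \<comment> \<open>Just after \<open>a\<close> the pairing is 1 - 2 = -1 and just before
    \<open>b\<close> it is 1 again, so some letter in between must raise it.\<close>
  have between: "\<exists>z. a < z \<and> z < b \<and> d z < 0" if "a < b" "b < l" "d a = 2" "d b = 2" for a b
  proof (rule ccontr)
    assume "\<not> ?thesis"
    hence nn: "sum d {Suc a..<b} \<ge> 0" by (intro sum_nonneg) force
    have "sum d {..<b} = sum d {..<Suc a} + sum d {Suc a..<b}"
      using that by (simp only: lessThan_atLeast0 sum.atLeastLessThan_concat Suc_leI le0)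
    with one[of a] one[of b] that nn show False by simp
  qed
  \<comment> \<open>\<open>q\<close> is the first occurrence of \<beta> outside \<open>I\<close>,
    with the end \<open>l\<close> of the word as default.\<close>
  define q where "q = (if \<exists>j<l. d j = 2 \<and> j \<notin> I then LEAST j. j < l \<and> d j = 2 \<and> j \<notin> I else l)"
  have q: "q < l \<and> d q = 2 \<and> q \<notin> I \<or> q = l"
    using LeastI_ex[of "\<lambda>j. j < l \<and> d j = 2 \<and> j \<notin> I"] by (auto simp: q_def)
  have below_q: "j \<in> I" if "j < q" "d j = 2" for j
  proof (rule ccontr)
    assume "j \<notin> I"
    moreover from that q have "j < l" by auto
    ultimately have "q = (LEAST j. j < l \<and> d j = 2 \<and> j \<notin> I)" using that by (auto simp: q_def)
    with not_less_Least[of j "\<lambda>j. j < l \<and> d j = 2 \<and> j \<notin> I"] that \<open>j < l\<close> \<open>j \<notin> I\<close>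
    show False by auto
  qed
  have ql: "q \<le> l" using q by auto
  \<comment> \<open>A letter of \<open>I\<close> beyond \<open>q\<close> that does not commute with
    \<beta> would drag \<open>q\<close> into \<open>I\<close>: directly if its pairing is negative,
    and through the negative letter supplied by \<open>between\<close> if it is another
    \<beta>.\<close>
  have above_q: "d j = 0" if "j \<in> I" "j \<ge> q" for j
  proof -
    have "j < l" using that I by auto
    with q that have q': "q < l" "d q = 2" "q \<notin> I" "q < j" by (auto simp: le_less)
    have "\<not> d j < 0" using ideal[of q j] q' that by auto
    moreover have "d j \<noteq> 2"
    proof
      assume "d j = 2"
      then obtain z where z: "q < z" "z < j" "d z < 0" using between[of q j] q' \<open>j < l\<close> by auto
      with ideal[of z j] that \<open>d j = 2\<close> have "z \<in> I" by auto
      with ideal[of q z] z q' show False by auto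
    qed
    ultimately show ?thesis using d[OF \<open>j < l\<close>] by auto
  qed
  \<comment> \<open>\<open>s\<close> is one past the last occurrence of \<beta> before
    \<open>q\<close>, or 0 if there is none. Thus \<open>{s..<q}\<close> is a stretch free of
    \<beta>.\<close>
  obtain s where s: "s = 0 \<or> s > 0 \<and> d (s - 1) = 2" "s \<le> q" and sq: "\<And>j. s \<le> j \<Longrightarrow> j < q \<Longrightarrow> d j \<noteq> 2"
  proof (cases "\<exists>j<q. d j = 2")
    case True
    define p where "p = Max {j. j < q \<and> d j = 2}"
    have "p \<in> {j. j < q \<and> d j = 2}" unfolding p_def using True by (intro Max_in) auto
    moreover have "j \<le> p" if "j < q" "d j = 2" for j
      unfolding p_def using that by (intro Max_ge) auto
    ultimately show ?thesis by (intro that[of "Suc p"]) (auto simp: Suc_le_eq dest: leD)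
  next
    case False
    thus ?thesis by (intro that[of 0]) auto
  qed
  have sq0: "d j \<le> 0" if "s \<le> j" "j < q" for j
    using d[of j] sq[of j] that ql by auto
  have pI: "s - 1 \<in> I" if "s > 0" using below_q[of "s - 1"] s that by auto
  \<comment> \<open>Letters before \<open>s\<close> that do not commute with \<beta> precede the
    \<beta> at \<open>s - 1\<close>, which belongs to \<open>I\<close>.\<close>
  have below_s: "j \<in> I" if "j < s" "d j \<noteq> 0" for j
  proof (cases "d j = 2")
    case True
    thus ?thesis using below_q that s by auto
  next
    case False
    hence neg: "d j < 0" using d[of j] that s ql by auto
    from that s(1) have "s > 0" "d (s - 1) = 2" by auto
    with neg that have "j < s - 1" by (cases "j = s - 1") auto
    with ideal[of j "s - 1"] pI \<open>s > 0\<close> \<open>d (s - 1) = 2\<close> neg show ?thesis by auto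
  qed
  \<comment> \<open>Only this window is left undecided: before \<open>s\<close> the ideal contains
    all letters with nonzero pairing, from \<open>q\<close> on none of them.\<close>
  define N where "N = I \<inter> {s..<q}"
  have sumI: "sum d I = sum d {..<s} + sum d N"
  proof -
    have fI: "finite I" using I finite_subset by blast
    have "sum d I = sum d (I \<inter> {..<s} \<union> N)"
      using fI above_q by (intro sum.mono_neutral_right) (auto simp: N_def not_less)
    also have "\<dots> = sum d (I \<inter> {..<s}) + sum d N"
      using fI by (intro sum.union_disjoint) (auto simp: N_def)
    also have "sum d (I \<inter> {..<s}) = sum d {..<s}"
      using below_s by (intro sum.mono_neutral_left) auto
    finally show ?thesis .
  qed
  have sumq: "sum d {..<q} = sum d {..<s} + sum d {s..<q}"
    using s(2) by (simp add: sum.atLeastLessThan_concat[of 0 s q, symmetric] lessThan_atLeast0)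
  have finN: "finite N" "N \<subseteq> {s..<q}" by (auto simp: N_def)
  have sumN: "sum d {s..<q} = sum d N + sum d ({s..<q} - N)"
    using finN by (simp add: sum.subset_diff)
  have N_le: "sum d N \<le> 0" "sum d ({s..<q} - N) \<le> 0"
    using sq0 finN by (auto intro!: sum_nonpos)
  have N0: "sum d N = 0 \<longleftrightarrow> (\<forall>j\<in>N. d j = 0)"
    using sq0 finN by (intro sum_int_le_0_iff) auto
  have D0: "sum d ({s..<q} - N) = 0 \<longleftrightarrow> (\<forall>j\<in>{s..<q} - N. d j = 0)"
    using sq0 by (intro sum_int_le_0_iff) auto
  \<comment> \<open>Only the letter \<open>q\<close> can be added, and it can be added exactly when
    no raising letter of the window is missing from \<open>I\<close>.\<close>
  have add: "(\<exists>j<l. d j = 2 \<and> j \<notin> I \<and> (\<forall>i<j. d i < 0 \<longrightarrow> i \<in> I)) \<longleftrightarrow> q < l \<and> sum d ({s..<q} - N) = 0"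
  proof
    assume "\<exists>j<l. d j = 2 \<and> j \<notin> I \<and> (\<forall>i<j. d i < 0 \<longrightarrow> i \<in> I)"
    then obtain j where j: "j < l" "d j = 2" "j \<notin> I" "\<And>i. i < j \<Longrightarrow> d i < 0 \<Longrightarrow> i \<in> I" by blast
    from j below_q have "q \<le> j" using not_less by blast
    hence "q < l" using j by simp
    with q have q': "d q = 2" "q \<notin> I" by auto
    have "j = q"
    proof (rule ccontr)
      assume "j \<noteq> q"
      with between[of q j] \<open>q \<le> j\<close> j q' obtain z where "q < z" "z < j" "d z < 0" by auto
      with j(4)[of z] ideal[of q z] q' show False by auto
    qed
    with j have "\<forall>j\<in>{s..<q} - N. d j = 0" using sq0 by (force simp: N_def)
    with D0 \<open>q < l\<close> show "q < l \<and> sum d ({s..<q} - N) = 0" by blast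
  next
    assume A: "q < l \<and> sum d ({s..<q} - N) = 0"
    have "i \<in> I" if "i < q" "d i < 0" for i
    proof (cases "i < s")
      case True
      thus ?thesis using below_s that by auto
    next
      case False
      with that have "i \<in> {s..<q}" by simp
      moreover have "\<forall>j\<in>{s..<q} - N. d j = 0" using A D0 by blast
      ultimately show ?thesis using that by (force simp: N_def)
    qed
    thus "\<exists>j<l. d j = 2 \<and> j \<notin> I \<and> (\<forall>i<j. d i < 0 \<longrightarrow> i \<in> I)" using A q by auto
  qed
  \<comment> \<open>Only the letter \<open>s - 1\<close> can be removed, and it can be removed
    exactly when \<open>I\<close> contains no raising letter of the window.\<close>
  have rem: "(\<exists>j\<in>I. d j = 2 \<and> (\<forall>i\<in>I. j < i \<longrightarrow> d i \<ge> 0)) \<longleftrightarrow> s > 0 \<and> sum d N = 0"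
  proof
    assume "\<exists>j\<in>I. d j = 2 \<and> (\<forall>i\<in>I. j < i \<longrightarrow> d i \<ge> 0)"
    then obtain j where j: "j \<in> I" "d j = 2" "\<And>i. i \<in> I \<Longrightarrow> j < i \<Longrightarrow> d i \<ge> 0" by blast
    have "j < q" using above_q[of j] j by (cases "j < q") auto
    hence "j < s" using sq[of j] j by (cases "j < s") auto
    hence s': "s > 0" "d (s - 1) = 2" using s by auto
    have "j = s - 1"
    proof (rule ccontr)
      assume "j \<noteq> s - 1"
      hence "j < s - 1" "s - 1 < l" using \<open>j < s\<close> s(2) ql by auto
      with between[of j "s - 1"] s' j obtain z where "j < z" "z < s - 1" "d z < 0" by auto
      with j(3)[of z] ideal[of z "s - 1"] s' pI show False by auto
    qed
    hence "\<forall>i\<in>N. d i = 0" using j(3) sq0 s' by (force simp: N_def)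
    with N0 s' show "s > 0 \<and> sum d N = 0" by blast
  next
    assume A: "s > 0 \<and> sum d N = 0"
    have "d i \<ge> 0" if "i \<in> I" "s - 1 < i" for i
      using above_q[of i] A N0 that by (cases "i < q") (auto simp: N_def)
    thus "\<exists>j\<in>I. d j = 2 \<and> (\<forall>i\<in>I. j < i \<longrightarrow> d i \<ge> 0)" using A pI s by auto
  qed
  have vs: "L - sum d {..<s} = (if s > 0 then -1 else L)"
  proof (cases s)
    case (Suc p)
    with one[of p] s ql show ?thesis by simp
  qed auto
  have vq: "L - sum d {..<q} = 1" if "q < l" using one[of q] q that by auto
  \<comment> \<open>The window climbs from -1 (or from \<open>L\<close> if \<open>s = 0\<close>) to
    1 (or to a value that is at most 0 if \<open>q = l\<close>), and the climb is split between
    \<open>N\<close> and its complement. Integrality of the two nonpositive sums leaves one value in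
    each case.\<close>
  show ?thesis unfolding add rem sumI
    using vs vq sumq sumN N_le L last q by (auto simp: of_bool_def split: if_splits)
qed

section \<open>Weyl groups of based root systems\<close>

text \<open>The form is constrained only on the span of \<open>R\<close>, where
  \<open>inner_dual\<close> is known to be a real bilinear form. The axioms allow proportional roots
  such as \<open>\<alpha>\<close> and \<open>2\<alpha>\<close>, so later arguments carry a positive
  factor \<open>c\<close> until integrality removes it.\<close>

locale root_basis = vector_space scale
  for scale :: "real \<Rightarrow> 'v::ab_group_add \<Rightarrow> 'v" +
  fixes ip :: "'v \<Rightarrow> 'v \<Rightarrow> real" and R B :: "'v set"
  assumes ip_add_left: "x \<in> span R \<Longrightarrow> y \<in> span R \<Longrightarrow> z \<in> span R \<Longrightarrow> ip (x + y) z = ip x z + ip y z"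
    and ip_scale_left: "x \<in> span R \<Longrightarrow> y \<in> span R \<Longrightarrow> ip (scale c x) y = c * ip x y"
    and ip_commute: "x \<in> span R \<Longrightarrow> y \<in> span R \<Longrightarrow> ip x y = ip y x"
    and ip_pos: "\<alpha> \<in> R \<Longrightarrow> ip \<alpha> \<alpha> > 0"
    and cartan_integer: "\<alpha> \<in> R \<Longrightarrow> \<beta> \<in> R \<Longrightarrow> 2 * ip \<beta> \<alpha> / ip \<alpha> \<alpha> \<in> \<int>"
    and root_reflection: "\<alpha> \<in> R \<Longrightarrow> \<beta> \<in> R \<Longrightarrow> \<beta> - scale (2 * ip \<beta> \<alpha> / ip \<alpha> \<alpha>) \<alpha> \<in> R"
    and base_roots: "B \<subseteq> R"
    and independent_base: "independent B"
    and span_base_eq: "span B = span R"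
    and base_combination: "\<beta> \<in> R \<Longrightarrow> \<exists>k :: 'v \<Rightarrow> nat.
          \<beta> = (\<Sum>\<alpha>\<in>B. scale (real (k \<alpha>)) \<alpha>) \<or> - \<beta> = (\<Sum>\<alpha>\<in>B. scale (real (k \<alpha>)) \<alpha>)"
begin

abbreviation "E \<equiv> span R"

text \<open>The scalar stands inside the second argument to agree literally with pairing against
  \<open>coroot\<close>; likewise \<open>reflect\<close> copies the convention of
  \<open>reflection\<close> to be the identity outside the span.\<close>

definition pair :: "'v \<Rightarrow> 'v \<Rightarrow> real" where
  "pair \<mu> \<alpha> = ip \<mu> (scale (2 / ip \<alpha> \<alpha>) \<alpha>)"

definition reflect :: "'v \<Rightarrow> 'v \<Rightarrow> 'v" where
  "reflect \<alpha> \<mu> = (if \<mu> \<in> E then \<mu> - scale (pair \<mu> \<alpha>) \<alpha> else \<mu>)"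

abbreviation act :: "'v list \<Rightarrow> 'v \<Rightarrow> 'v" where
  "act \<equiv> fold reflect"

lemma root_in_E [simp]: "\<alpha> \<in> R \<Longrightarrow> \<alpha> \<in> E" by (rule span_base)

lemma base_in_R: "\<alpha> \<in> B \<Longrightarrow> \<alpha> \<in> R" using base_roots by auto

lemma ip_scale_right: "x \<in> E \<Longrightarrow> y \<in> E \<Longrightarrow> ip x (scale c y) = c * ip x y"
  by (simp add: ip_commute[of x] ip_scale_left span_scale)

lemma ip_minus_left: "x \<in> E \<Longrightarrow> y \<in> E \<Longrightarrow> ip (- x) y = - ip x y"
  using ip_scale_left[of x y "-1"] by simp

lemma ip_diff_left: "x \<in> E \<Longrightarrow> y \<in> E \<Longrightarrow> z \<in> E \<Longrightarrow> ip (x - y) z = ip x z - ip y z"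
  using ip_add_left[of x "- y" z] by (simp add: ip_minus_left span_neg)

lemma ip_diff_right: "x \<in> E \<Longrightarrow> y \<in> E \<Longrightarrow> z \<in> E \<Longrightarrow> ip x (y - z) = ip x y - ip x z"
  by (simp add: ip_commute[of x] ip_diff_left span_diff)

lemma ip_zero_left: "y \<in> E \<Longrightarrow> ip 0 y = 0"
  using ip_scale_left[of 0 y 0] by (simp add: span_zero)

lemma ip_sum_left:
  "(\<And>i. i \<in> A \<Longrightarrow> f i \<in> E) \<Longrightarrow> y \<in> E \<Longrightarrow> ip (\<Sum>i\<in>A. f i) y = (\<Sum>i\<in>A. ip (f i) y)"
  by (induction A rule: infinite_finite_induct) (auto simp: ip_zero_left ip_add_left span_sum)

lemma ip_sum_right:
  "(\<And>i. i \<in> A \<Longrightarrow> f i \<in> E) \<Longrightarrow> y \<in> E \<Longrightarrow> ip y (\<Sum>i\<in>A. f i) = (\<Sum>i\<in>A. ip y (f i))"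
  by (simp add: ip_commute[of y] ip_sum_left span_sum)

lemma pair_eq: "\<mu> \<in> E \<Longrightarrow> \<alpha> \<in> E \<Longrightarrow> pair \<mu> \<alpha> = 2 * ip \<mu> \<alpha> / ip \<alpha> \<alpha>"
  by (simp add: pair_def ip_scale_right)

lemma pair_add: "x \<in> E \<Longrightarrow> y \<in> E \<Longrightarrow> \<alpha> \<in> E \<Longrightarrow> pair (x + y) \<alpha> = pair x \<alpha> + pair y \<alpha>"
  by (simp add: pair_eq ip_add_left span_add add_divide_distrib ring_distribs)

lemma pair_diff: "x \<in> E \<Longrightarrow> y \<in> E \<Longrightarrow> \<alpha> \<in> E \<Longrightarrow> pair (x - y) \<alpha> = pair x \<alpha> - pair y \<alpha>"
  by (simp add: pair_eq ip_diff_left span_diff diff_divide_distrib ring_distribs)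

lemma pair_scale: "x \<in> E \<Longrightarrow> \<alpha> \<in> E \<Longrightarrow> pair (scale c x) \<alpha> = c * pair x \<alpha>"
  by (simp add: pair_eq ip_scale_left span_scale)

lemma pair_sum:
  "(\<And>i. i \<in> A \<Longrightarrow> f i \<in> E) \<Longrightarrow> \<alpha> \<in> E \<Longrightarrow> pair (\<Sum>i\<in>A. f i) \<alpha> = (\<Sum>i\<in>A. pair (f i) \<alpha>)"
  by (simp add: pair_eq ip_sum_left span_sum sum_distrib_left sum_divide_distrib)

lemma pair_self: "\<alpha> \<in> R \<Longrightarrow> pair \<alpha> \<alpha> = 2"
  using ip_pos[of \<alpha>] by (simp add: pair_eq)

lemma pair_in_Ints: "\<alpha> \<in> R \<Longrightarrow> \<beta> \<in> R \<Longrightarrow> pair \<beta> \<alpha> \<in> \<int>"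
  using cartan_integer by (simp add: pair_eq)

lemma pair_eq_0_commute: "\<alpha> \<in> R \<Longrightarrow> \<beta> \<in> R \<Longrightarrow> pair \<alpha> \<beta> = 0 \<longleftrightarrow> pair \<beta> \<alpha> = 0"
  using ip_pos[of \<alpha>] ip_pos[of \<beta>] by (simp add: pair_eq ip_commute[of \<alpha> \<beta>])

lemma reflect_in_E: "\<alpha> \<in> E \<Longrightarrow> reflect \<alpha> \<mu> \<in> E \<longleftrightarrow> \<mu> \<in> E"
  by (simp add: reflect_def span_diff span_scale)

lemma reflect_outside: "\<mu> \<notin> E \<Longrightarrow> reflect \<alpha> \<mu> = \<mu>"
  by (simp add: reflect_def)

lemma reflect_root: "\<alpha> \<in> R \<Longrightarrow> \<beta> \<in> R \<Longrightarrow> reflect \<alpha> \<beta> \<in> R"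
  using root_reflection by (simp add: reflect_def pair_eq)

lemma reflect_self: "\<alpha> \<in> R \<Longrightarrow> reflect \<alpha> \<alpha> = - \<alpha>"
  using scale_left_diff_distrib[of 1 2 \<alpha>] by (simp add: reflect_def pair_self)

lemma reflect_reflect: "\<alpha> \<in> R \<Longrightarrow> reflect \<alpha> (reflect \<alpha> \<mu>) = \<mu>"
  by (cases "\<mu> \<in> E")
    (simp_all add: reflect_def span_diff span_scale pair_diff pair_scale pair_self algebra_simps)

lemma reflect_add: "x \<in> E \<Longrightarrow> y \<in> E \<Longrightarrow> \<alpha> \<in> E \<Longrightarrow> reflect \<alpha> (x + y) = reflect \<alpha> x + reflect \<alpha> y"
  by (simp add: reflect_def span_add pair_add algebra_simps)

lemma reflect_scale: "x \<in> E \<Longrightarrow> \<alpha> \<in> E \<Longrightarrow> reflect \<alpha> (scale c x) = scale c (reflect \<alpha> x)"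
  by (simp add: reflect_def span_scale pair_scale algebra_simps)

lemma ip_reflect: "\<alpha> \<in> R \<Longrightarrow> x \<in> E \<Longrightarrow> y \<in> E \<Longrightarrow> ip (reflect \<alpha> x) (reflect \<alpha> y) = ip x y"
  using ip_pos[of \<alpha>]
  by (simp add: reflect_def span_diff span_scale ip_diff_left ip_diff_right ip_scale_left
      ip_scale_right pair_eq ip_commute[of \<alpha> y] field_simps)

text \<open>For \<open>exchange\<close>, where a root is identified only up to a positive
  multiple.\<close>

lemma reflect_scale_root:
  assumes "\<alpha> \<in> E" "c \<noteq> 0"
  shows "reflect (scale c \<alpha>) = reflect \<alpha>"
  using assms by (intro ext) (auto simp: reflect_def pair_eq span_scale ip_scale_left ip_scale_right)

lemma act_in_E: "set ws \<subseteq> R \<Longrightarrow> act ws \<mu> \<in> E \<longleftrightarrow> \<mu> \<in> E"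
  by (induction ws arbitrary: \<mu>) (auto simp: reflect_in_E)

lemma act_outside: "\<mu> \<notin> E \<Longrightarrow> act ws \<mu> = \<mu>"
  by (induction ws arbitrary: \<mu>) (auto simp: reflect_outside)

lemma act_root: "set ws \<subseteq> R \<Longrightarrow> \<beta> \<in> R \<Longrightarrow> act ws \<beta> \<in> R"
  by (induction ws arbitrary: \<beta>) (auto simp: reflect_root)

lemma act_add: "set ws \<subseteq> R \<Longrightarrow> x \<in> E \<Longrightarrow> y \<in> E \<Longrightarrow> act ws (x + y) = act ws x + act ws y"
  by (induction ws arbitrary: x y) (auto simp: reflect_add reflect_in_E)

lemma act_scale: "set ws \<subseteq> R \<Longrightarrow> x \<in> E \<Longrightarrow> act ws (scale c x) = scale c (act ws x)"
  by (induction ws arbitrary: x) (auto simp: reflect_scale reflect_in_E)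

lemma act_minus: "set ws \<subseteq> R \<Longrightarrow> x \<in> E \<Longrightarrow> act ws (- x) = - act ws x"
  using act_scale[of ws x "-1"] by simp

lemma ip_act: "set ws \<subseteq> R \<Longrightarrow> x \<in> E \<Longrightarrow> y \<in> E \<Longrightarrow> ip (act ws x) (act ws y) = ip x y"
  by (induction ws arbitrary: x y) (auto simp: ip_reflect reflect_in_E)

lemma act_rev_act: "set ws \<subseteq> R \<Longrightarrow> act (rev ws) (act ws \<mu>) = \<mu>"
  by (induction ws arbitrary: \<mu>) (auto simp: reflect_reflect)

lemma act_act_rev: "set ws \<subseteq> R \<Longrightarrow> act ws (act (rev ws) \<mu>) = \<mu>"
  using act_rev_act[of "rev ws"] by simp

lemma pair_act: "set ws \<subseteq> R \<Longrightarrow> x \<in> E \<Longrightarrow> \<gamma> \<in> E \<Longrightarrow> pair (act ws x) (act ws \<gamma>) = pair x \<gamma>"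
  by (simp add: pair_eq act_in_E ip_act)

lemma pair_act_left: "set ws \<subseteq> R \<Longrightarrow> x \<in> E \<Longrightarrow> \<gamma> \<in> E \<Longrightarrow> pair (act ws x) \<gamma> = pair x (act (rev ws) \<gamma>)"
  using pair_act[of ws x "act (rev ws) \<gamma>"] act_in_E[of "rev ws" \<gamma>] by (simp add: act_act_rev)

lemma act_reflect:
  assumes "set ws \<subseteq> R" "\<gamma> \<in> R"
  shows "act ws (reflect \<gamma> \<mu>) = reflect (act ws \<gamma>) (act ws \<mu>)"
proof (cases "\<mu> \<in> E")
  case True
  have "act ws (\<mu> + scale (- pair \<mu> \<gamma>) \<gamma>) = act ws \<mu> + act ws (scale (- pair \<mu> \<gamma>) \<gamma>)"
    using True assms by (intro act_add span_scale) auto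
  also have "act ws (scale (- pair \<mu> \<gamma>) \<gamma>) = scale (- pair \<mu> \<gamma>) (act ws \<gamma>)"
    using True assms by (intro act_scale) auto
  finally have "act ws (reflect \<gamma> \<mu>) = act ws \<mu> - scale (pair \<mu> \<gamma>) (act ws \<gamma>)"
    using True by (simp add: reflect_def[of \<gamma>])
  thus ?thesis using True assms by (simp add: reflect_def[of "act ws \<gamma>"] act_in_E pair_act)
qed (use assms in \<open>simp add: reflect_outside act_outside\<close>)

section \<open>Positive roots and simple reflections\<close>

abbreviation coef :: "'v \<Rightarrow> 'v \<Rightarrow> real" where
  "coef \<equiv> representation B"

text \<open>On roots this is positivity with respect to \<open>B\<close>. The vector 0 also
  qualifies, so antisymmetry has to be restricted to roots.\<close>

definition nonneg :: "'v \<Rightarrow> bool" where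
  "nonneg \<gamma> \<longleftrightarrow> (\<forall>b. coef \<gamma> b \<ge> 0)"

lemma zero_notin_R: "0 \<notin> R"
  using ip_pos[of 0] ip_zero_left[of 0] by (auto simp: span_zero)

lemma finite_base: "finite B"
proof (rule ccontr)
  assume inf: "infinite B"
  then obtain \<beta> where "\<beta> \<in> B" by fastforce
  hence "\<beta> \<in> R" by (rule base_in_R)
  \<comment> \<open>A sum over an infinite set is 0 by convention, so an infinite base would express
    every root as 0.\<close>
  with base_combination[of \<beta>] inf have "\<beta> = 0" by auto
  with \<open>\<beta> \<in> R\<close> zero_notin_R show False by simp
qed

lemma coef_add: "x \<in> E \<Longrightarrow> y \<in> E \<Longrightarrow> coef (x + y) b = coef x b + coef y b"
  using span_base_eq by (simp add: representation_add independent_base)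

lemma coef_diff: "x \<in> E \<Longrightarrow> y \<in> E \<Longrightarrow> coef (x - y) b = coef x b - coef y b"
  using span_base_eq by (simp add: representation_diff independent_base)

lemma coef_minus: "x \<in> E \<Longrightarrow> coef (- x) b = - coef x b"
  using span_base_eq by (simp add: representation_neg independent_base)

lemma coef_scale: "x \<in> E \<Longrightarrow> coef (scale c x) b = c * coef x b"
  using span_base_eq by (simp add: representation_scale independent_base)

lemma coef_base: "\<beta> \<in> B \<Longrightarrow> coef \<beta> b = (if b = \<beta> then 1 else 0)"
  by (simp add: representation_basis independent_base)

lemma coef_expand: "x \<in> E \<Longrightarrow> (\<Sum>b\<in>B. scale (coef x b) b) = x"
  by (rule sum_representation_eq) (auto simp: independent_base finite_base span_base_eq)

lemma coef_outside: "b \<notin> B \<Longrightarrow> coef x b = 0"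
  using representation_ne_zero by blast

lemma coef_sum_base:
  assumes "b \<in> B"
  shows "coef (\<Sum>a\<in>B. scale (f a) a) b = f b"
proof -
  have "coef (\<Sum>a\<in>B. scale (f a) a) b = (\<Sum>a\<in>B. f a * coef a b)"
    by (simp add: representation_sum independent_base span_scale span_base representation_scale)
  also have "\<dots> = (\<Sum>a\<in>B. if a = b then f a else 0)"
    by (intro sum.cong) (auto simp: coef_base)
  finally show ?thesis using assms finite_base by simp
qed

lemma root_coef_cases:
  assumes "\<gamma> \<in> R"
  obtains "\<And>b. coef \<gamma> b \<in> \<nat>" | "\<And>b. coef (- \<gamma>) b \<in> \<nat>"
proof -
  from base_combination[OF assms] obtain k :: "'v \<Rightarrow> nat"
    where k: "\<gamma> = (\<Sum>\<alpha>\<in>B. scale (real (k \<alpha>)) \<alpha>) \<or> - \<gamma> = (\<Sum>\<alpha>\<in>B. scale (real (k \<alpha>)) \<alpha>)" by blast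
  have "coef (\<Sum>\<alpha>\<in>B. scale (real (k \<alpha>)) \<alpha>) b \<in> \<nat>" for b
    by (cases "b \<in> B") (simp_all add: coef_sum_base coef_outside)
  with k that show ?thesis by auto
qed

lemma root_coef_Ints:
  assumes "\<gamma> \<in> R"
  shows "coef \<gamma> b \<in> \<int>"
  using assms
proof (rule root_coef_cases)
  assume "\<And>b. coef (- \<gamma>) b \<in> \<nat>"
  hence "coef (- \<gamma>) b \<in> \<int>" using Nats_subset_Ints by blast
  thus ?thesis using assms by (simp add: coef_minus)
qed (use Nats_subset_Ints in blast)

lemma root_nonneg_cases:
  assumes "\<gamma> \<in> R"
  shows "nonneg \<gamma> \<or> nonneg (- \<gamma>)"
proof -
  have "x \<ge> 0" if "x \<in> \<nat>" for x :: real using that by (elim Nats_cases) simp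
  with assms show ?thesis by (elim root_coef_cases) (simp_all add: nonneg_def)
qed

lemma nonneg_antisym: "\<gamma> \<in> R \<Longrightarrow> nonneg \<gamma> \<Longrightarrow> \<not> nonneg (- \<gamma>)"
proof
  assume \<gamma>: "\<gamma> \<in> R" and n: "nonneg \<gamma>" "nonneg (- \<gamma>)"
  hence "coef \<gamma> b = 0" for b
    by (metis coef_minus nonneg_def neg_0_le_iff_le order_antisym root_in_E)
  with coef_expand[of \<gamma>] \<gamma> zero_notin_R show False by auto
qed

lemma nonneg_base: "\<beta> \<in> B \<Longrightarrow> nonneg \<beta>"
  by (simp add: nonneg_def coef_base)

text \<open>The reflection in \<open>\<beta>\<close> alters only the coefficient of
  \<open>\<beta>\<close>. If the sign of the root flips nevertheless, all other coefficients are
  both nonnegative and nonpositive.\<close>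

lemma multiple_of_simple_if_reflect_not_nonneg:
  assumes \<beta>: "\<beta> \<in> B" and \<gamma>: "\<gamma> \<in> R" "nonneg \<gamma>" and neg: "\<not> nonneg (reflect \<beta> \<gamma>)"
  shows "\<exists>c>0. \<gamma> = scale c \<beta>"
proof -
  have \<beta>R: "\<beta> \<in> R" using \<beta> by (rule base_in_R)
  with neg \<gamma> have "nonneg (- reflect \<beta> \<gamma>)" using root_nonneg_cases reflect_root by blast
  hence "coef \<gamma> b \<le> 0" if "b \<noteq> \<beta>" for b
  proof -
    have "coef (- reflect \<beta> \<gamma>) b = - coef \<gamma> b"
      using that \<beta> \<beta>R \<gamma>
      by (simp add: reflect_def coef_diff coef_scale coef_minus coef_base span_scale span_diff)
    with \<open>nonneg (- reflect \<beta> \<gamma>)\<close> show ?thesis unfolding nonneg_def by (metis neg_0_le_iff_le)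
  qed
  with \<gamma> have z: "coef \<gamma> b = 0" if "b \<noteq> \<beta>" for b
    using that by (auto simp: nonneg_def intro: order_antisym)
  have "\<gamma> = (\<Sum>b\<in>B. scale (coef \<gamma> b) b)" using coef_expand \<gamma> by simp
  also have "\<dots> = (\<Sum>b\<in>B. if b = \<beta> then scale (coef \<gamma> \<beta>) \<beta> else 0)"
    by (rule sum.cong) (auto simp: z)
  finally have eq: "\<gamma> = scale (coef \<gamma> \<beta>) \<beta>" using finite_base \<beta> by simp
  moreover have "coef \<gamma> \<beta> \<noteq> 0" using eq \<gamma> zero_notin_R by auto
  ultimately show ?thesis using \<gamma> by (intro exI[of _ "coef \<gamma> \<beta>"]) (auto simp: nonneg_def less_le)
qed

text \<open>The root \<open>reflect \<beta> \<alpha>\<close> has coefficient 1 at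
  \<open>\<alpha>\<close> and \<open>- pair \<alpha> \<beta>\<close> at \<open>\<beta>\<close>; a
  root cannot have coefficients of both signs.\<close>

lemma pair_simple_nonpos:
  assumes "\<alpha> \<in> B" "\<beta> \<in> B" "\<alpha> \<noteq> \<beta>"
  shows "pair \<alpha> \<beta> \<le> 0"
proof (rule ccontr)
  assume pos: "\<not> pair \<alpha> \<beta> \<le> 0"
  have R: "\<alpha> \<in> R" "\<beta> \<in> R" using assms base_in_R by auto
  have "coef (reflect \<beta> \<alpha>) \<alpha> = 1" "coef (reflect \<beta> \<alpha>) \<beta> = - pair \<alpha> \<beta>"
    using R assms by (auto simp: reflect_def coef_diff coef_scale coef_base span_scale)
  moreover have "nonneg (reflect \<beta> \<alpha>) \<or> nonneg (- reflect \<beta> \<alpha>)"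
    using R by (intro root_nonneg_cases reflect_root)
  moreover have "reflect \<beta> \<alpha> \<in> E" using R by (simp add: reflect_in_E)
  ultimately have "0 \<le> - pair \<alpha> \<beta> \<or> (0::real) \<le> - 1"
    unfolding nonneg_def by (metis coef_minus)
  with pos show False by simp
qed

lemma reflect_commute_iff:
  assumes "\<alpha> \<in> B" "\<beta> \<in> B"
  shows "reflect \<alpha> \<circ> reflect \<beta> = reflect \<beta> \<circ> reflect \<alpha> \<longleftrightarrow> \<alpha> = \<beta> \<or> pair \<alpha> \<beta> = 0"
proof (cases "\<alpha> = \<beta>")
  case False
  have R: "\<alpha> \<in> R" "\<beta> \<in> R" using assms base_in_R by auto
  show ?thesis
  proof
    assume "reflect \<alpha> \<circ> reflect \<beta> = reflect \<beta> \<circ> reflect \<alpha>"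
    hence "reflect \<alpha> (reflect \<beta> \<alpha>) = reflect \<beta> (reflect \<alpha> \<alpha>)" by (metis comp_apply)
    \<comment> \<open>The two coefficients are \<open>- pair \<alpha> \<beta>\<close> and
      \<open>pair \<alpha> \<beta>\<close>.\<close>
    hence "coef (reflect \<alpha> (reflect \<beta> \<alpha>)) \<beta> = coef (reflect \<beta> (reflect \<alpha> \<alpha>)) \<beta>" by simp
    thus "\<alpha> = \<beta> \<or> pair \<alpha> \<beta> = 0" using R assms False
      by (simp add: reflect_def coef_diff coef_add coef_scale coef_base span_scale span_diff pair_self
          pair_diff pair_scale)
  next
    assume "\<alpha> = \<beta> \<or> pair \<alpha> \<beta> = 0"
    with False have p: "pair \<alpha> \<beta> = 0" "pair \<beta> \<alpha> = 0" using pair_eq_0_commute R by auto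
    show "reflect \<alpha> \<circ> reflect \<beta> = reflect \<beta> \<circ> reflect \<alpha>"
      using R p by (intro ext) (simp add: reflect_def pair_diff pair_scale span_diff span_scale)
  qed
qed simp

text \<open>At the first letter that turns the image of \<open>\<gamma>\<close> negative, that image
  is a positive multiple of the letter. Moving the reflection in \<open>\<gamma>\<close> through the
  prefix conjugates it into the reflection in this letter, and the two cancel.\<close>

lemma exchange:
  assumes ws: "set ws \<subseteq> B" and \<gamma>: "\<gamma> \<in> R" "nonneg \<gamma>" and neg: "\<not> nonneg (act ws \<gamma>)"
  obtains k c where "k < length ws" "c > 0" "act (take k ws) \<gamma> = scale c (ws ! k)"
    "act ws \<circ> reflect \<gamma> = act (take k ws @ drop (Suc k) ws)"
proof -
  define k where "k = (LEAST k. \<not> nonneg (act (take (Suc k) ws) \<gamma>))"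
  have len: "length ws > 0" using \<gamma> neg by auto
  hence "\<not> nonneg (act (take (Suc (length ws - 1)) ws) \<gamma>)" using neg by simp
  hence 1: "\<not> nonneg (act (take (Suc k) ws) \<gamma>)" and "k \<le> length ws - 1"
    unfolding k_def by (rule LeastI, rule Least_le)
  with len have k: "k < length ws" by linarith
  have 2: "nonneg (act (take k ws) \<gamma>)"
  proof (cases k)
    case (Suc j)
    with not_less_Least[of j "\<lambda>k. \<not> nonneg (act (take (Suc k) ws) \<gamma>)"] show ?thesis
      by (simp add: k_def)
  qed (use \<gamma> in simp)
  have wsR: "set (take i ws) \<subseteq> R" "set (drop i ws) \<subseteq> R" for i
    using ws base_roots set_take_subset set_drop_subset by (metis order_trans)+
  have \<beta>: "ws ! k \<in> B" using ws k by (meson nth_mem subsetD)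
  have take_Suc: "act (take (Suc k) ws) = reflect (ws ! k) \<circ> act (take k ws)"
    using k by (simp add: take_Suc_conv_app_nth)
  obtain c where c: "c > 0" "act (take k ws) \<gamma> = scale c (ws ! k)"
    using multiple_of_simple_if_reflect_not_nonneg[OF \<beta>, of "act (take k ws) \<gamma>"] 1 2
      act_root[OF wsR(1) \<gamma>(1)] take_Suc by auto
  have "act (take (Suc k) ws) (reflect \<gamma> \<mu>) = act (take k ws) \<mu>" for \<mu>
  proof -
    have "act (take k ws) (reflect \<gamma> \<mu>) = reflect (scale c (ws ! k)) (act (take k ws) \<mu>)"
      using act_reflect[OF wsR(1) \<gamma>(1)] c(2) by simp
    also have "reflect (scale c (ws ! k)) = reflect (ws ! k)"
      using c(1) \<beta> base_in_R by (intro reflect_scale_root) auto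
    finally show ?thesis using \<beta> base_in_R by (simp add: take_Suc reflect_reflect)
  qed
  moreover have "act ws = act (drop (Suc k) ws) \<circ> act (take (Suc k) ws)"
    by (metis append_take_drop_id fold_append)
  ultimately have "act ws \<circ> reflect \<gamma> = act (take k ws @ drop (Suc k) ws)"
    by (auto simp: fun_eq_iff)
  with k c show ?thesis by (rule that)
qed

section \<open>Reduced words and their inversions\<close>

definition reduced :: "'v list \<Rightarrow> bool" where
  "reduced ws \<longleftrightarrow> set ws \<subseteq> B \<and> (\<forall>vs. set vs \<subseteq> B \<longrightarrow> act vs = act ws \<longrightarrow> length ws \<le> length vs)"

lemma reducedD: "reduced ws \<Longrightarrow> set vs \<subseteq> B \<Longrightarrow> act vs = act ws \<Longrightarrow> length ws \<le> length vs"
  by (simp add: reduced_def)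

text \<open>Reversal inverts a word of involutions, so this is the letter at \<open>j\<close> pulled
  back to the start of the word.\<close>

definition inversion :: "'v list \<Rightarrow> nat \<Rightarrow> 'v" where
  "inversion ws j = act (rev (take j ws)) (ws ! j)"

context
  fixes ws
  assumes red: "reduced ws"
begin

lemma reduced_subset: "set ws \<subseteq> B" "set ws \<subseteq> R" "set (take i ws) \<subseteq> B" "set (drop i ws) \<subseteq> B"
    "set (take i ws) \<subseteq> R" "set (drop i ws) \<subseteq> R" "j < length ws \<Longrightarrow> ws ! j \<in> B"
  using red base_roots set_take_subset[of i ws] set_drop_subset[of i ws] nth_mem[of j ws]
  by (auto simp: reduced_def)

lemma inversion_root: "j < length ws \<Longrightarrow> inversion ws j \<in> R"
  using reduced_subset base_in_R unfolding inversion_def by (intro act_root) auto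

lemma reduced_split: "j < length ws \<Longrightarrow> act ws = act (drop (Suc j) ws) \<circ> reflect (ws ! j) \<circ> act (take j ws)"
  by (subst id_take_nth_drop, assumption) (auto simp: fun_eq_iff)

text \<open>If it were negative, \<open>exchange\<close> for the reversed prefix would rewrite the
  first \<open>j + 1\<close> letters as \<open>j - 1\<close> letters.\<close>

lemma inversion_nonneg:
  assumes j: "j < length ws"
  shows "nonneg (inversion ws j)"
proof (rule ccontr)
  let ?vs = "rev (take j ws)" and ?\<beta> = "ws ! j"
  assume neg: "\<not> nonneg (inversion ws j)"
  have \<beta>: "?\<beta> \<in> B" using j by (rule reduced_subset)
  obtain k c where k: "k < length ?vs" and
    eq: "act ?vs \<circ> reflect ?\<beta> = act (take k ?vs @ drop (Suc k) ?vs)"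
    by (rule exchange[of ?vs ?\<beta>])
       (use neg \<beta> base_in_R nonneg_base reduced_subset in \<open>auto simp: inversion_def\<close>)
  define us where "us = take k ?vs @ drop (Suc k) ?vs"
  have us: "set us \<subseteq> B" "length us < j"
    using reduced_subset(3)[of j] k j set_take_subset[of k ?vs] set_drop_subset[of "Suc k" ?vs]
    by (auto simp: us_def)
  have usR: "set us \<subseteq> R" using us base_roots by auto
  have "act (rev us) = reflect ?\<beta> \<circ> act (take j ws)"
  proof
    fix \<mu>
    define \<nu> where "\<nu> = act (rev us) \<mu>"
    have "\<mu> = act us \<nu>" using act_act_rev[OF usR] by (simp add: \<nu>_def)
    also have "\<dots> = act ?vs (reflect ?\<beta> \<nu>)" using eq by (metis comp_apply us_def)
    finally have "(reflect ?\<beta> \<circ> act (take j ws)) \<mu> = reflect ?\<beta> (act (take j ws) (act ?vs (reflect ?\<beta> \<nu>)))"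
      by simp
    also have "\<dots> = \<nu>" using act_act_rev[OF reduced_subset(5)] \<beta> base_in_R reflect_reflect by simp
    finally show "act (rev us) \<mu> = (reflect ?\<beta> \<circ> act (take j ws)) \<mu>" by (simp add: \<nu>_def)
  qed
  hence "act (rev us @ drop (Suc j) ws) = act ws" using reduced_split[OF j] by (simp add: comp_assoc)
  moreover have "set (rev us @ drop (Suc j) ws) \<subseteq> B" using us reduced_subset by auto
  ultimately have "length ws \<le> length (rev us @ drop (Suc j) ws)" using red by (intro reducedD)
  with us j show False by simp
qed

text \<open>The letter at \<open>j\<close> negates itself, so the word sends the inversion to minus
  the image of that letter under the rest of the word. If this were positive,
  \<open>exchange\<close> on the rest would absorb the letter at \<open>j\<close> together with one
  more.\<close>

lemma act_inversion_not_nonneg: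
  assumes j: "j < length ws"
  shows "\<not> nonneg (act ws (inversion ws j))"
proof
  let ?vs = "drop (Suc j) ws" and ?\<beta> = "ws ! j"
  assume nn: "nonneg (act ws (inversion ws j))"
  have \<beta>: "?\<beta> \<in> B" "?\<beta> \<in> R" using j reduced_subset base_in_R by auto
  have "act ws (inversion ws j) = act ?vs (- ?\<beta>)"
    using \<beta> act_act_rev[OF reduced_subset(5)]
    by (subst reduced_split[OF j]) (simp add: inversion_def reflect_self)
  also have "\<dots> = - act ?vs ?\<beta>" using \<beta> reduced_subset by (intro act_minus) auto
  finally have "\<not> nonneg (act ?vs ?\<beta>)"
    using nn nonneg_antisym[of "act ?vs ?\<beta>"] act_root[of ?vs ?\<beta>] \<beta> reduced_subset by auto
  then obtain k c where k: "k < length ?vs" and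
    eq: "act ?vs \<circ> reflect ?\<beta> = act (take k ?vs @ drop (Suc k) ?vs)"
    by (rule exchange[of ?vs ?\<beta>, rotated 3]) (use \<beta> nonneg_base reduced_subset in auto)
  let ?us = "take j ws @ (take k ?vs @ drop (Suc k) ?vs)"
  have "act ?us = act ws" using reduced_split[OF j] eq by (simp add: comp_assoc)
  moreover have "set ?us \<subseteq> B"
    using reduced_subset(3)[of j] reduced_subset(4)[of "Suc j"]
      set_take_subset[of k ?vs] set_drop_subset[of "Suc k" ?vs] by auto
  ultimately have "length ws \<le> length ?us" using red by (intro reducedD)
  with k j show False by simp
qed

end

text \<open>Undoing either word turns the equation into one between a root and a multiple of a
  simple root. Integrality of root coefficients makes both \<open>c\<close> and its inverse
  integers.\<close>

lemma scale_root_orbit: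
  assumes \<alpha>: "\<alpha> \<in> B" and \<beta>: "\<beta> \<in> B" and ws: "set ws \<subseteq> B" "set vs \<subseteq> B"
    and c: "c > 0" and eq: "act ws \<alpha> = scale c (act vs \<beta>)"
  shows "c = 1"
proof -
  have R: "set ws \<subseteq> R" "set vs \<subseteq> R" "\<alpha> \<in> R" "\<beta> \<in> R" using assms base_roots by auto
  have inE: "act ws \<alpha> \<in> E" "act vs \<beta> \<in> E" using R by (simp_all add: act_in_E)
  have Ra: "act (rev ws) (act vs \<beta>) \<in> R" "act (rev vs) (act ws \<alpha>) \<in> R"
    using R by (auto intro!: act_root)
  have "\<alpha> = act (rev ws) (scale c (act vs \<beta>))" using eq act_rev_act[OF R(1), of \<alpha>] by simp
  also have "\<dots> = scale c (act (rev ws) (act vs \<beta>))" using R inE by (intro act_scale) auto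
  finally have "coef \<alpha> \<alpha> = c * coef (act (rev ws) (act vs \<beta>)) \<alpha>"
    using Ra by (metis coef_scale root_in_E)
  then obtain m :: int where m: "1 = c * m"
    using root_coef_Ints[OF Ra(1)] coef_base[OF \<alpha>] by (metis Ints_cases)
  have "scale c \<beta> = act (rev vs) (act ws \<alpha>)"
    using R by (simp add: eq act_scale act_in_E act_rev_act)
  hence "c * coef \<beta> \<beta> = coef (act (rev vs) (act ws \<alpha>)) \<beta>"
    using R by (metis coef_scale root_in_E)
  then obtain n :: int where n: "c = n"
    using root_coef_Ints[OF Ra(2)] coef_base[OF \<beta>] by (metis Ints_cases mult.right_neutral)
  have "n * m = 1" using m n by (metis of_int_1 of_int_eq_iff of_int_mult)
  with c n have "n = 1" by (metis of_int_0_less_iff zmult_eq_1_iff zless_add1_eq not_numeral_less_zero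
        one_neq_neg_one neg_0_less_iff_less not_one_less_zero)
  with n show ?thesis by simp
qed

text \<open>Inversions are the positive roots made negative by \<open>act ws\<close>, a condition that does not mention the word.\<close>

lemma inversion_in_other_reduced_word:
  assumes red: "reduced ws" "reduced vs" and eq: "act ws = act vs" and j: "j < length ws"
  obtains i where "i < length vs" "inversion ws j = inversion vs i"
proof -
  let ?\<gamma> = "inversion ws j"
  have vsR: "set vs \<subseteq> B" using red by (simp add: reduced_def)
  obtain i c where i: "i < length vs" "c > 0" "act (take i vs) ?\<gamma> = scale c (vs ! i)"
    using exchange[OF vsR inversion_root inversion_nonneg] act_inversion_not_nonneg red j eq
    by metis
  note sub = reduced_subset[OF red(1)] and sub' = reduced_subset[OF red(2)]
  have vi: "vs ! i \<in> B" "vs ! i \<in> R" and wj: "ws ! j \<in> B" using sub sub' base_in_R i j by auto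
  have "?\<gamma> = act (rev (take i vs)) (scale c (vs ! i))"
    using i(3) act_rev_act[OF sub'(5)] by metis
  also have "\<dots> = scale c (act (rev (take i vs)) (vs ! i))"
    using sub' vi by (intro act_scale) auto
  finally have g: "?\<gamma> = scale c (act (rev (take i vs)) (vs ! i))" .
  have "c = 1"
    by (rule scale_root_orbit[OF wj vi(1) _ _ i(2) g[unfolded inversion_def]]) (use sub sub' in auto)
  with g i show ?thesis by (intro that[of i]) (simp_all add: inversion_def)
qed

text \<open>Moving the prefix to the other side, each pairing along a reduced word is the pairing of
  \<open>lam\<close> with an inversion, and both words have the same inversions.\<close>

lemma minuscule_chain_reduced:
  assumes red: "reduced ws" "reduced vs" and eq: "act ws = act vs" and lam: "lam \<in> E"
    and chain: "\<And>i. i < length vs \<Longrightarrow> pair (act (take i vs) lam) (vs ! i) = 1"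
    and j: "j < length ws"
  shows "pair (act (take j ws) lam) (ws ! j) = 1"
proof -
  have conv: "pair (act (take i us) lam) (us ! i) = pair lam (inversion us i)"
    if "reduced us" "i < length us" for us i
    unfolding inversion_def
    using reduced_subset[OF that(1)] that lam base_in_R by (intro pair_act_left) auto
  obtain i where "i < length vs" "inversion ws j = inversion vs i"
    by (rule inversion_in_other_reduced_word[OF red eq j])
  thus ?thesis using conv[OF red(1) j] conv[OF red(2)] chain by simp
qed

text \<open>The inverse of a longest element makes \<open>\<beta>\<close> negative, since otherwise
  appending \<open>\<beta>\<close> would lengthen the word. The pairing therefore has the sign of a
  dominant weight against a negative root.\<close>

lemma longest_antidominant:
  assumes red: "reduced us" and longest: "\<And>vs. reduced vs \<Longrightarrow> length vs \<le> length us"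
    and lam: "lam \<in> E" and dom: "\<And>\<beta>. \<beta> \<in> B \<Longrightarrow> pair lam \<beta> \<ge> 0" and \<beta>: "\<beta> \<in> B"
  shows "pair (act us lam) \<beta> \<le> 0"
proof -
  let ?\<delta> = "act (rev us) \<beta>"
  have usR: "set us \<subseteq> R" "set us \<subseteq> B" using reduced_subset[OF red] by auto
  have \<beta>R: "\<beta> \<in> R" using \<beta> by (rule base_in_R)
  have \<delta>: "?\<delta> \<in> R" using usR \<beta>R by (intro act_root) auto
  have "\<not> nonneg ?\<delta>"
  proof
    assume nn: "nonneg ?\<delta>"
    \<comment> \<open>A shortest word for the element extended by \<open>\<beta>\<close> has at most
      \<open>length us\<close> letters by maximality. As it sends \<open>?\<delta>\<close> to
      \<open>- \<beta>\<close>, \<open>exchange\<close> deletes a letter and leaves a word for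
      \<open>us\<close> that is too short.\<close>
    define n where "n = (LEAST n. \<exists>vs. set vs \<subseteq> B \<and> act vs = act (us @ [\<beta>]) \<and> length vs = n)"
    have "\<exists>n vs. set vs \<subseteq> B \<and> act vs = act (us @ [\<beta>]) \<and> length vs = n"
      using usR \<beta> by (intro exI[of _ "length (us @ [\<beta>])"] exI[of _ "us @ [\<beta>]"]) auto
    from LeastI_ex[OF this] obtain vs
      where vs: "set vs \<subseteq> B" "act vs = act (us @ [\<beta>])" "length vs = n"
      unfolding n_def by blast
    have "n \<le> length xs" if "set xs \<subseteq> B" "act xs = act (us @ [\<beta>])" for xs
      unfolding n_def by (rule Least_le) (use that in blast)
    with vs have "reduced vs" by (simp add: reduced_def)
    with longest vs have n: "n \<le> length us" by blast
    have "act vs ?\<delta> = - \<beta>" using vs \<beta>R act_act_rev[OF usR(1), of \<beta>] by (simp add: reflect_self)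
    hence "\<not> nonneg (act vs ?\<delta>)" using nonneg_antisym[OF \<beta>R] nonneg_base[OF \<beta>] by auto
    then obtain k c where k: "k < length vs"
      and eq: "act vs \<circ> reflect ?\<delta> = act (take k vs @ drop (Suc k) vs)"
      using exchange[OF vs(1) \<delta> nn] by metis
    have "act (take k vs @ drop (Suc k) vs) = act us"
    proof
      fix \<mu>
      have "act vs (reflect ?\<delta> \<mu>) = reflect \<beta> (act us (reflect ?\<delta> \<mu>))" using vs by simp
      also have "\<dots> = act us \<mu>"
        using act_reflect[OF usR(1) \<delta>] act_act_rev[OF usR(1)] reflect_reflect[OF \<beta>R] by simp
      finally show "act (take k vs @ drop (Suc k) vs) \<mu> = act us \<mu>" using eq by (metis comp_apply)
    qed
    moreover have "set (take k vs @ drop (Suc k) vs) \<subseteq> B"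
      using vs(1) set_take_subset[of k vs] set_drop_subset[of "Suc k" vs] by auto
    ultimately have "length us \<le> length (take k vs @ drop (Suc k) vs)" using red by (intro reducedD)
    with k n vs show False by simp
  qed
  with \<delta> have neg: "nonneg (- ?\<delta>)" using root_nonneg_cases by blast
  have ip_base: "ip lam b \<ge> 0" if "b \<in> B" for b
    using dom[OF that] ip_pos[OF base_in_R[OF that]] lam base_in_R[OF that]
    by (simp add: pair_eq zero_le_divide_iff zero_le_mult_iff)
  have "ip lam (- ?\<delta>) = ip lam (\<Sum>b\<in>B. scale (coef (- ?\<delta>) b) b)"
    using \<delta> by (simp add: coef_expand span_neg)
  also have "\<dots> = (\<Sum>b\<in>B. coef (- ?\<delta>) b * ip lam b)"
    using lam base_in_R by (simp add: ip_sum_right ip_scale_right span_scale)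
  also have "\<dots> \<ge> 0" using ip_base neg by (intro sum_nonneg) (simp add: nonneg_def)
  finally have "ip lam ?\<delta> \<le> 0"
    using lam \<delta> ip_scale_right[of lam ?\<delta> "-1"] by simp
  thus ?thesis using pair_act_left[OF usR(1) lam, of \<beta>] \<beta>R lam \<delta> ip_pos[OF \<delta>]
    by (simp add: pair_eq divide_nonpos_pos)
qed

end

section \<open>Homomesy for minuscule words\<close>

context root_basis
begin

definition noncommuting :: "'v list \<Rightarrow> (nat \<times> nat) set" where
  "noncommuting ws = {(j, k). j < k \<and> k < length ws \<and>
     reflect (ws ! j) \<circ> reflect (ws ! k) \<noteq> reflect (ws ! k) \<circ> reflect (ws ! j)}"

text \<open>Repeats \<open>heap_order\<close> with the abstract reflections, so that the two can be
  identified once the root system of the Lie algebra is plugged in.\<close>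

definition heap_le :: "'v list \<Rightarrow> (nat \<times> nat) set" where
  "heap_le ws = Restr ((noncommuting ws)\<^sup>*) (heap ws)"

lemma noncommuting_rtrancl_le: "(j, k) \<in> (noncommuting ws)\<^sup>* \<Longrightarrow> j \<le> k"
  by (induction rule: rtrancl_induct) (auto simp: noncommuting_def)

lemma heap_le_order: "trans (heap_le ws)" "antisym (heap_le ws)" "refl_on (heap ws) (heap_le ws)"
proof -
  show "trans (heap_le ws)" by (auto simp: heap_le_def intro!: transI)
  show "antisym (heap_le ws)"
    by (auto simp: heap_le_def intro!: antisymI dest!: noncommuting_rtrancl_le)
  show "refl_on (heap ws) (heap_le ws)" by (auto simp: heap_le_def refl_on_def)
qed

lemma noncommuting_heap_le: "(j, k) \<in> noncommuting ws \<Longrightarrow> (j, k) \<in> heap_le ws"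
  by (auto simp: heap_le_def heap_def) (auto simp: noncommuting_def)

lemma ideal_noncommuting:
  "I \<in> order_ideals (heap ws) (heap_le ws) \<Longrightarrow> (j, k) \<in> noncommuting ws \<Longrightarrow> k \<in> I \<Longrightarrow> j \<in> I"
  using noncommuting_heap_le[of j k ws] by (auto simp: order_ideals_def heap_le_def)

lemma finite_heap: "finite (heap ws)" by (simp add: heap_def)

section \<open>The weight attached to an order ideal\<close>

context
  fixes ws :: "'v list" and lam :: 'v
  assumes wsB: "set ws \<subseteq> B" and lam: "lam \<in> E"
    and integral: "\<And>\<beta>. \<beta> \<in> B \<Longrightarrow> pair lam \<beta> \<in> \<int>"
    and dominant: "\<And>\<beta>. \<beta> \<in> B \<Longrightarrow> pair lam \<beta> \<ge> 0"
    and chain: "\<And>j. j < length ws \<Longrightarrow> pair (act (take j ws) lam) (ws ! j) = 1"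
    and antidominant: "\<And>\<beta>. \<beta> \<in> B \<Longrightarrow> pair (act ws lam) \<beta> \<le> 0"
begin

definition ideal_weight :: "nat set \<Rightarrow> 'v" where
  "ideal_weight I = lam - (\<Sum>j\<in>I. ws ! j)"

lemma ws_base: "j < length ws \<Longrightarrow> ws ! j \<in> B"
  using wsB nth_mem by blast

lemma ws_E: "j < length ws \<Longrightarrow> ws ! j \<in> E"
  using ws_base base_in_R by auto

lemma act_take_eq: "j \<le> length ws \<Longrightarrow> act (take j ws) lam = ideal_weight {..<j}"
proof (induction j)
  case (Suc j)
  hence "act (take (Suc j) ws) lam = reflect (ws ! j) (act (take j ws) lam)"
    by (simp add: take_Suc_conv_app_nth)
  also have "\<dots> = act (take j ws) lam - ws ! j"
  proof -
    have "set (take j ws) \<subseteq> R" using wsB base_roots set_take_subset by fast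
    hence "act (take j ws) lam \<in> E" using lam by (simp add: act_in_E)
    thus ?thesis using chain Suc.prems by (simp add: reflect_def)
  qed
  finally show ?case using Suc by (simp add: ideal_weight_def algebra_simps)
qed (simp add: ideal_weight_def)

text \<open>The combinatorics is that of \<open>ideal_pairing_eq\<close>. What remains is to
  recognise minimal and maximal elements by comparing positions in the word: for letters other than
  \<open>\<beta>\<close>, not commuting with \<open>\<beta>\<close> means having a negative
  pairing.\<close>

lemma pair_ideal_weight:
  assumes \<beta>: "\<beta> \<in> B" and I: "I \<in> order_ideals (heap ws) (heap_le ws)"
  shows "pair (ideal_weight I) \<beta>
    = of_bool (\<exists>j\<in>minimal_elements (heap_le ws) (heap ws - I). ws ! j = \<beta>)
    - of_bool (\<exists>j\<in>maximal_elements (heap_le ws) I. ws ! j = \<beta>)"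
proof -
  \<comment> \<open>The pairings are integers, so rounding down only changes their type.\<close>
  define d where "d j = \<lfloor>pair (ws ! j) \<beta>\<rfloor>" for j
  define L where "L = \<lfloor>pair lam \<beta>\<rfloor>"
  have \<beta>R: "\<beta> \<in> R" using \<beta> by (rule base_in_R)
  have d: "real_of_int (d j) = pair (ws ! j) \<beta>" if "j < length ws" for j
    unfolding d_def using pair_in_Ints[OF \<beta>R base_in_R[OF ws_base[OF that]]] by (elim Ints_cases) simp
  have L: "real_of_int L = pair lam \<beta>"
    unfolding L_def using integral[OF \<beta>] by (elim Ints_cases) simp
  have pw: "pair (ideal_weight A) \<beta> = real_of_int (L - sum d A)" if "A \<subseteq> heap ws" for A
  proof -
    have A: "ws ! j \<in> E" "real_of_int (d j) = pair (ws ! j) \<beta>" if "j \<in> A" for j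
      using that \<open>A \<subseteq> heap ws\<close> ws_E d by (auto simp: heap_def)
    thus ?thesis using lam \<beta>R
      by (simp add: ideal_weight_def pair_diff span_sum pair_sum L)
  qed
  have d2: "d j = 2 \<longleftrightarrow> ws ! j = \<beta>" and dle: "d j = 2 \<or> d j \<le> 0"
    and dneg: "d j < 0 \<longleftrightarrow> reflect (ws ! j) \<circ> reflect \<beta> \<noteq> reflect \<beta> \<circ> reflect (ws ! j)"
    if j: "j < length ws" for j
    using d[OF j] pair_self[OF \<beta>R] pair_simple_nonpos[OF ws_base[OF j] \<beta>]
      reflect_commute_iff[OF ws_base[OF j] \<beta>]
    by (cases "ws ! j = \<beta>"; auto)+
  let ?J = "noncommuting ws"
  have nc: "(i, j) \<in> ?J" if "i < j" "j < length ws" "d i = 2 \<and> d j < 0 \<or> d i < 0 \<and> d j = 2" for i j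
    using that d2[of i] d2[of j] dneg[of i] dneg[of j] by (auto simp: noncommuting_def)
  have ncD: "i < j" "j < length ws" "d j = 2 \<Longrightarrow> d i < 0" "d i = 2 \<Longrightarrow> d j < 0"
    if "(i, j) \<in> ?J" for i j
    using that d2[of i] d2[of j] dneg[of i] dneg[of j] by (auto simp: noncommuting_def)
  have IP: "I \<subseteq> {..<length ws}" using I by (auto simp: order_ideals_def heap_def)
  have add: "(\<exists>j\<in>minimal_elements (heap_le ws) (heap ws - I). ws ! j = \<beta>) \<longleftrightarrow>
      (\<exists>j<length ws. d j = 2 \<and> j \<notin> I \<and> (\<forall>i<j. d i < 0 \<longrightarrow> i \<in> I))"
  proof
    assume "\<exists>j\<in>minimal_elements (heap_le ws) (heap ws - I). ws ! j = \<beta>"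
    then obtain j where j: "j < length ws" "j \<notin> I" "ws ! j = \<beta>"
      and min: "\<And>i. i \<in> heap ws - I \<Longrightarrow> (i, j) \<in> heap_le ws \<Longrightarrow> i = j"
      by (auto simp: minimal_elements_def heap_def)
    have "i \<in> I" if "i < j" "d i < 0" for i
    proof (rule ccontr)
      assume "i \<notin> I"
      have "(i, j) \<in> heap_le ws" using nc[of i j] that j d2[of j] by (auto simp: heap_le_def heap_def)
      with min[of i] \<open>i \<notin> I\<close> that j show False by (auto simp: heap_def)
    qed
    with j d2[of j] show "\<exists>j<length ws. d j = 2 \<and> j \<notin> I \<and> (\<forall>i<j. d i < 0 \<longrightarrow> i \<in> I)" by auto
  next
    assume "\<exists>j<length ws. d j = 2 \<and> j \<notin> I \<and> (\<forall>i<j. d i < 0 \<longrightarrow> i \<in> I)"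
    then obtain j where j: "j < length ws" "d j = 2" "j \<notin> I" "\<And>i. i < j \<Longrightarrow> d i < 0 \<Longrightarrow> i \<in> I" by blast
    \<comment> \<open>The last generating relation of a chain from \<open>i\<close> up to
      \<open>j\<close> starts at a letter \<open>z\<close> that is already in \<open>I\<close>, and
      then \<open>i\<close> is in \<open>I\<close> as well.\<close>
    have "i = j" if i: "i \<in> heap ws - I" "(i, j) \<in> heap_le ws" for i
    proof (rule ccontr)
      assume "i \<noteq> j"
      moreover have "(i, j) \<in> ?J\<^sup>*" using i by (simp add: heap_le_def)
      ultimately obtain z where z: "(i, z) \<in> ?J\<^sup>*" "(z, j) \<in> ?J" by (auto elim: rtranclE)
      have "z \<in> I" using ncD(1,3)[OF z(2)] j by auto
      moreover have "(i, z) \<in> heap_le ws" using z i \<open>z \<in> I\<close> IP by (auto simp: heap_le_def heap_def)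
      ultimately show False using I i by (auto simp: order_ideals_def)
    qed
    with j d2[of j] show "\<exists>j\<in>minimal_elements (heap_le ws) (heap ws - I). ws ! j = \<beta>"
      by (intro bexI[of _ j]) (auto simp: minimal_elements_def heap_def)
  qed
  have rem: "(\<exists>j\<in>maximal_elements (heap_le ws) I. ws ! j = \<beta>) \<longleftrightarrow>
      (\<exists>j\<in>I. d j = 2 \<and> (\<forall>i\<in>I. j < i \<longrightarrow> d i \<ge> 0))"
  proof
    assume "\<exists>j\<in>maximal_elements (heap_le ws) I. ws ! j = \<beta>"
    then obtain j where j: "j \<in> I" "ws ! j = \<beta>"
      and max: "\<And>i. i \<in> I \<Longrightarrow> (j, i) \<in> heap_le ws \<Longrightarrow> i = j"
      by (auto simp: maximal_elements_def)
    have jl: "j < length ws" using j IP by auto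
    have "d i \<ge> 0" if "i \<in> I" "j < i" for i
    proof (rule ccontr)
      assume "\<not> d i \<ge> 0"
      moreover have "i < length ws" using that IP by auto
      ultimately have "(j, i) \<in> heap_le ws" using nc[of j i] that j jl d2[of j]
        by (auto simp: heap_le_def heap_def)
      with max[of i] that show False by auto
    qed
    with j d2[of j] jl show "\<exists>j\<in>I. d j = 2 \<and> (\<forall>i\<in>I. j < i \<longrightarrow> d i \<ge> 0)" by auto
  next
    assume "\<exists>j\<in>I. d j = 2 \<and> (\<forall>i\<in>I. j < i \<longrightarrow> d i \<ge> 0)"
    then obtain j where j: "j \<in> I" "d j = 2" "\<And>i. i \<in> I \<Longrightarrow> j < i \<Longrightarrow> d i \<ge> 0" by blast
    have jl: "j < length ws" using j IP by auto
    \<comment> \<open>Dually, the first generating relation of a chain from \<open>j\<close> up to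
      \<open>i\<close> ends at a letter of \<open>I\<close> with negative pairing.\<close>
    have "i = j" if i: "i \<in> I" "(j, i) \<in> heap_le ws" for i
    proof (rule ccontr)
      assume "i \<noteq> j"
      moreover have "(j, i) \<in> ?J\<^sup>*" using i by (simp add: heap_le_def)
      ultimately obtain z where z: "(j, z) \<in> ?J" "(z, i) \<in> ?J\<^sup>*" by (auto elim: converse_rtranclE)
      have "(z, i) \<in> heap_le ws" using z i ncD(2)[OF z(1)] IP by (auto simp: heap_le_def heap_def)
      hence "z \<in> I" using I i ncD(2)[OF z(1)] by (auto simp: order_ideals_def heap_def)
      with j(3) ncD(1,4)[OF z(1)] j(2) show False by force
    qed
    with j d2[OF jl] show "\<exists>j\<in>maximal_elements (heap_le ws) I. ws ! j = \<beta>"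
      by (intro bexI[of _ j]) (auto simp: maximal_elements_def)
  qed
  have "L - sum d I = of_bool (\<exists>j<length ws. d j = 2 \<and> j \<notin> I \<and> (\<forall>i<j. d i < 0 \<longrightarrow> i \<in> I))
           - of_bool (\<exists>j\<in>I. d j = 2 \<and> (\<forall>i\<in>I. j < i \<longrightarrow> d i \<ge> 0))"
  proof (rule ideal_pairing_eq)
    show "L \<ge> 0" using L dominant[OF \<beta>] by (metis of_int_0_le_iff)
    show "L - sum d {..<k} = 1" if "k < length ws" "d k = 2" for k
    proof -
      have "real_of_int (L - sum d {..<k}) = pair (act (take k ws) lam) \<beta>"
        using pw[of "{..<k}"] act_take_eq[of k] that by (auto simp: heap_def)
      also have "\<dots> = 1" using chain[of k] that d2[of k] by simp
      finally show ?thesis by linarith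
    qed
    have "real_of_int (L - sum d {..<length ws}) = pair (act ws lam) \<beta>"
      using pw[of "{..<length ws}"] act_take_eq[of "length ws"] by (auto simp: heap_def)
    with antidominant[OF \<beta>] show "L - sum d {..<length ws} \<le> 0" by linarith
    show "i \<in> I" if "i < j" "j \<in> I" "d i = 2 \<and> d j < 0 \<or> d i < 0 \<and> d j = 2" for i j
      using ideal_noncommuting[OF I nc[OF that(1) _ that(3)] that(2)] that IP by auto
  qed (use dle IP in auto)
  moreover have "pair (ideal_weight I) \<beta> = real_of_int (L - sum d I)"
    using pw IP by (simp add: heap_def)
  ultimately show ?thesis unfolding add rem by simp
qed

text \<open>Pairing with \<open>\<omega>\<close> counts labels: \<open>\<omega>\<close> is
  orthogonal to every simple root but \<open>\<alpha>\<close>, and its product with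
  \<open>\<alpha>\<close> is half of \<open>ip \<alpha> \<alpha>\<close>.\<close>

lemma card_label_class_eq:
  assumes \<alpha>: "\<alpha> \<in> B" and \<omega>: "\<omega> \<in> E" "\<And>\<beta>. \<beta> \<in> B \<Longrightarrow> pair \<omega> \<beta> = (if \<beta> = \<alpha> then 1 else 0)"
    and I: "I \<subseteq> heap ws"
  shows "real (card (I \<inter> heap_label_class ws \<alpha>)) * ip \<alpha> \<alpha> / 2 = ip lam \<omega> - ip (ideal_weight I) \<omega>"
proof -
  have base: "ip b \<omega> = (if b = \<alpha> then ip \<alpha> \<alpha> / 2 else 0)" if "b \<in> B" for b
    using \<omega>(2)[OF that] \<omega>(1) that base_in_R[OF that] ip_pos[OF base_in_R[OF that]]
    by (auto simp: pair_eq ip_commute[of b \<omega>] split: if_splits)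
  have IE: "ws ! j \<in> E" "ws ! j \<in> B" if "j \<in> I" for j
    using that I ws_E ws_base by (auto simp: heap_def)
  have fI: "finite I" using I finite_heap finite_subset by blast
  have "ip (ideal_weight I) \<omega> = ip lam \<omega> - (\<Sum>j\<in>I. ip (ws ! j) \<omega>)"
    using lam \<omega> IE by (simp add: ideal_weight_def ip_diff_left span_sum ip_sum_left)
  also have "(\<Sum>j\<in>I. ip (ws ! j) \<omega>) = (\<Sum>j\<in>I. if ws ! j = \<alpha> then ip \<alpha> \<alpha> / 2 else 0)"
    using IE base by (intro sum.cong) auto
  also have "\<dots> = (\<Sum>j\<in>I \<inter> heap_label_class ws \<alpha>. ip \<alpha> \<alpha> / 2)"
    using fI I by (intro sum.mono_neutral_cong_right) (auto simp: heap_label_class_def)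
  finally show ?thesis by simp
qed

theorem label_class_mesic:
  assumes \<alpha>: "\<alpha> \<in> B" and \<omega>: "\<omega> \<in> E" "\<And>\<beta>. \<beta> \<in> B \<Longrightarrow> pair \<omega> \<beta> = (if \<beta> = \<alpha> then 1 else 0)"
  shows "mesic (order_ideals (heap ws) (heap_le ws)) (fon_der_flaass (heap ws) (heap_le ws))
    (\<lambda>I. real (card (I \<inter> heap_label_class ws \<alpha>))) (2 * ip lam \<omega> / ip \<alpha> \<alpha>)"
proof -
  let ?J = "order_ideals (heap ws) (heap_le ws)" and ?\<Psi> = "fon_der_flaass (heap ws) (heap_le ws)"
  define rem :: "nat set \<Rightarrow> 'v \<Rightarrow> real" where "rem I b = of_bool (\<exists>j\<in>maximal_elements (heap_le ws) I. ws ! j = b)" for I b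
  \<comment> \<open>Expanding \<open>\<omega>\<close> in simple roots and using
    \<open>ip \<mu> b = ip b b / 2 * pair \<mu> b\<close> dictates these weights; the minus sign is
    there because the count falls as \<open>ip (ideal_weight I) \<omega>\<close> grows.\<close>
  define g where "g I = - (\<Sum>b\<in>B. coef \<omega> b * ip b b * rem I b) / ip \<alpha> \<alpha>" for I
  have \<alpha>pos: "ip \<alpha> \<alpha> > 0" using \<alpha> base_in_R ip_pos by blast
  show ?thesis
  proof (rule mesicI[where g = g])
    have "?J \<subseteq> Pow (heap ws)" by (auto simp: order_ideals_def)
    thus "finite ?J" by (rule finite_subset) (simp add: finite_heap)
    show "bij_betw ?\<Psi> ?J ?J" by (intro bij_betw_fon_der_flaass finite_heap heap_le_order)
  next
    fix I assume I: "I \<in> ?J"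
    hence IP: "I \<subseteq> heap ws" by (auto simp: order_ideals_def)
    have wE: "ideal_weight I \<in> E"
      unfolding ideal_weight_def using lam ws_E IP by (intro span_diff span_sum) (auto simp: heap_def)
    have "ip (ideal_weight I) b = ip b b / 2 * (rem (?\<Psi> I) b - rem I b)" if b: "b \<in> B" for b
    proof -
      have "pair (ideal_weight I) b = rem (?\<Psi> I) b - rem I b"
        unfolding pair_ideal_weight[OF b I] rem_def
        by (simp add: maximal_elements_fon_der_flaass[OF heap_le_order I])
      thus ?thesis using wE b base_in_R[OF b] ip_pos[of b] by (simp add: pair_eq field_simps)
    qed
    note ip_base = this
    have "ip (ideal_weight I) \<omega> = (\<Sum>b\<in>B. coef \<omega> b * ip (ideal_weight I) b)"
      using wE base_in_R
      by (subst coef_expand[OF \<omega>(1), symmetric]) (simp add: ip_sum_right ip_scale_right span_scale)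
    also have "\<dots> = (\<Sum>b\<in>B. coef \<omega> b * (ip b b / 2 * (rem (?\<Psi> I) b - rem I b)))"
      by (intro sum.cong refl) (simp only: ip_base)
    also have "\<dots> = (\<Sum>b\<in>B. (coef \<omega> b * ip b b * rem (?\<Psi> I) b - coef \<omega> b * ip b b * rem I b) / 2)"
      by (intro sum.cong refl) (simp add: algebra_simps)
    also have "\<dots> = ip \<alpha> \<alpha> / 2 * (g I - g (?\<Psi> I))"
      using \<alpha>pos unfolding sum_divide_distrib[symmetric] sum_subtractf g_def by (simp add: field_simps)
    finally have "ip (ideal_weight I) \<omega> = ip \<alpha> \<alpha> / 2 * (g I - g (?\<Psi> I))" .
    with card_label_class_eq[OF \<alpha> \<omega> IP] \<alpha>pos
    show "real (card (I \<inter> heap_label_class ws \<alpha>)) = 2 * ip lam \<omega> / ip \<alpha> \<alpha> + g (?\<Psi> I) - g I"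
      by (simp add: field_simps)
  qed
qed

end

end

section \<open>Linear algebra and the Killing form\<close>

context vector_space
begin

text \<open>Applying \<open>T\<close> minus the eigenvalue of one component removes that component
  and multiplies the others by nonzero factors, so induction on their number applies.\<close>

lemma eigenvector_components_in_subspace:
  assumes T: "Vector_Spaces.linear scale scale T" and E: "subspace E" "\<And>x. x \<in> E \<Longrightarrow> T x \<in> E"
    and "finite F" "inj_on c F" "\<And>i. i \<in> F \<Longrightarrow> T (x i) = scale (c i) (x i)"
    and "(\<Sum>i\<in>F. x i) \<in> E" "i \<in> F"
  shows "x i \<in> E"
  using assms(4-)
proof (induction F arbitrary: x i rule: finite_induct)
  case (insert j F)
  interpret T: Vector_Spaces.linear scale scale T by (rule T)
  let ?S = "\<Sum>i\<in>insert j F. x i"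
  have "T ?S - scale (c j) ?S = (\<Sum>i\<in>F. scale (c i - c j) (x i))"
    using insert.hyps insert.prems
    by (simp add: T.add T.sum algebra_simps scale_sum_right sum_subtractf)
  moreover have "T ?S - scale (c j) ?S \<in> E"
    using insert.prems E by (intro subspace_diff subspace_scale) auto
  ultimately have "(\<Sum>i\<in>F. scale (c i - c j) (x i)) \<in> E" by simp
  hence "scale (c k - c j) (x k) \<in> E" if "k \<in> F" for k
    using insert.prems insert.hyps that
    by (intro insert.IH[of "\<lambda>i. scale (c i - c j) (x i)"]) (auto simp: T.scale mult.commute)
  moreover have "c k \<noteq> c j" if "k \<in> F" for k
    using that insert.hyps(2) inj_onD[OF insert.prems(1), of k j] by auto
  ultimately have F: "x k \<in> E" if "k \<in> F" for k
    using subspace_scale[OF E(1), of "scale (c k - c j) (x k)" "inverse (c k - c j)"] that by auto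
  have "?S - (\<Sum>k\<in>F. x k) \<in> E"
    by (intro subspace_diff[OF E(1)] subspace_sum[OF E(1)] insert.prems(3) F)
  hence "x j \<in> E" using insert.hyps by simp
  with F insert.prems show ?case by auto
qed simp

text \<open>Split a common eigenvector of the old operators into eigencomponents of the new one.
  Each old eigenspace is invariant under the new operator by commutation, hence contains these
  components.\<close>

lemma span_simultaneous_eigenvectors:
  assumes "finite F"
    and "\<And>H. H \<in> F \<Longrightarrow> Vector_Spaces.linear scale scale (T H)"
    and "\<And>H. H \<in> F \<Longrightarrow> span {x. \<exists>c. T H x = scale c x} = UNIV"
    and "\<And>H K x. H \<in> F \<Longrightarrow> K \<in> F \<Longrightarrow> T H (T K x) = T K (T H x)"
  shows "span {x. \<forall>H\<in>F. \<exists>c. T H x = scale c x} = UNIV"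
  using assms
proof (induction F rule: finite_induct)
  case (insert H F)
  let ?S = "{x. \<forall>K\<in>insert H F. \<exists>c. T K x = scale c x}"
  have "x \<in> span ?S" if x: "\<forall>K\<in>F. \<exists>c. T K x = scale c x" for x
  proof -
    have "x \<in> span {x. \<exists>c. T H x = scale c x}" using insert.prems by simp
    then obtain Y r where Y: "finite Y" "Y \<subseteq> {x. \<exists>c. T H x = scale c x}"
      and xY: "(\<Sum>y\<in>Y. scale (r y) y) = x" unfolding span_explicit by blast
    from Y(2) have "\<forall>y\<in>Y. \<exists>c. T H y = scale c y" by blast
    then obtain ev where ev: "\<And>y. y \<in> Y \<Longrightarrow> T H y = scale (ev y) y" by metis
    interpret TH: Vector_Spaces.linear scale scale "T H" using insert.prems by simp
    define z where "z c = (\<Sum>y\<in>{y\<in>Y. ev y = c}. scale (r y) y)" for c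
    have xz: "(\<Sum>c\<in>ev ` Y. z c) = x"
      unfolding z_def xY[symmetric] using Y(1) by (intro sum.image_gen[symmetric])
    have THz: "T H (z c) = scale c (z c)" for c
      using ev by (simp add: z_def TH.sum TH.scale scale_sum_right mult.commute)
    have "\<exists>a. T K (z c) = scale a (z c)" if c: "c \<in> ev ` Y" and K: "K \<in> F" for c K
    proof -
      from x K obtain a where a: "T K x = scale a x" by blast
      interpret TK: Vector_Spaces.linear scale scale "T K" using insert.prems K by simp
      have "z c \<in> {v. T K v = scale a v}"
      proof (rule eigenvector_components_in_subspace[where T = "T H" and c = "\<lambda>c. c"])
        show "subspace {v. T K v = scale a v}"
          by (rule subspaceI) (simp_all add: TK.add TK.scale algebra_simps)
        show "T H v \<in> {v. T K v = scale a v}" if "v \<in> {v. T K v = scale a v}" for v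
          using that insert.prems(3)[of H K v] K by (simp add: TH.scale)
      qed (use Y(1) a xz THz c TH.linear_axioms in auto)
      thus ?thesis by blast
    qed
    with THz have "z c \<in> span ?S" if "c \<in> ev ` Y" for c
      using that by (intro span_base) blast
    with xz show ?thesis by (metis (no_types, lifting) span_sum)
  qed
  hence "span {x. \<forall>K\<in>F. \<exists>c. T K x = scale c x} \<subseteq> span ?S"
    by (intro span_minimal subspace_span) blast
  with insert show ?case by auto
qed simp

lemma independent_distinct_eigenvectors:
  assumes T: "Vector_Spaces.linear scale scale T" and "inj c"
    and v: "\<And>k :: 'i. v k \<noteq> 0" "\<And>k. T (v k) = scale (c k) (v k)"
  shows "inj v" "independent (range v)"
proof -
  show "inj v"
  proof (rule injI)
    fix i j assume "v i = v j"
    hence "scale (c i) (v i) = scale (c j) (v i)" using v(2) by metis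
    with v(1) \<open>inj c\<close> show "i = j" by (auto dest: injD)
  qed
  show "independent (range v)"
    unfolding independent_explicit_finite_subsets
  proof (intro allI impI ballI)
    fix S u w assume S: "S \<subseteq> range v" "finite S" and z: "(\<Sum>w\<in>S. scale (u w) w) = 0" and w: "w \<in> S"
    interpret T: Vector_Spaces.linear scale scale T by (rule T)
    have vi: "v (inv v w) = w" if "w \<in> S" for w using that S by (intro f_inv_into_f) auto
    \<comment> \<open>The zero subspace is invariant, so each component of a vanishing sum
      vanishes.\<close>
    have "scale (u w) w \<in> {0}"
    proof (rule eigenvector_components_in_subspace[OF T, where c = "\<lambda>w. c (inv v w)" and F = S
          and x = "\<lambda>w. scale (u w) w" and i = w])
      show "inj_on (\<lambda>w. c (inv v w)) S"
        using \<open>inj c\<close> vi by (intro inj_onI) (metis injD)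
      show "T (scale (u w) w) = scale (c (inv v w)) (scale (u w) w)" if "w \<in> S" for w
        using v(2)[of "inv v w"] vi[OF that] by (simp add: T.scale mult.commute)
    qed (use S z w in auto)
    moreover have "w \<noteq> 0" using v(1) vi[OF w] by metis
    ultimately show "u w = 0" by simp
  qed
qed

end

section \<open>Traces\<close>

context finite_dimensional_vector_space
begin

lemma representation_linear:
  assumes B: "independent B" "span B = UNIV" and C: "independent C" "span C = UNIV"
    and f: "Vector_Spaces.linear scale scale f"
  shows "representation B (f y) b = (\<Sum>c\<in>C. representation C y c * representation B (f c) b)"
proof -
  interpret f: Vector_Spaces.linear scale scale f by (rule f)
  have "f y = f (\<Sum>c\<in>C. scale (representation C y c) c)"
    using C finiteI_independent by (simp add: sum_representation_eq)
  also have "\<dots> = (\<Sum>c\<in>C. scale (representation C y c) (f c))" by (simp add: f.sum f.scale)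
  finally show ?thesis using B by (simp add: representation_sum representation_scale)
qed

lemma trace_basis_independent:
  assumes B: "independent B" "span B = UNIV" and C: "independent C" "span C = UNIV"
    and f: "Vector_Spaces.linear scale scale f"
  shows "(\<Sum>b\<in>B. representation B (f b) b) = (\<Sum>c\<in>C. representation C (f c) c)"
proof -
  have "(\<Sum>b\<in>B. representation B (f b) b)
      = (\<Sum>c\<in>C. \<Sum>b\<in>B. representation B (f c) b * representation C b c)"
    by (subst representation_linear[OF B C f], subst sum.swap) (simp add: mult.commute)
  also have "\<dots> = (\<Sum>c\<in>C. representation C (f c) c)"
    using representation_linear[OF C B linear_ident, symmetric] by simp
  finally show ?thesis .
qed

lemma trace_commute:
  assumes B: "independent B" "span B = UNIV"
    and f: "Vector_Spaces.linear scale scale f" and g: "Vector_Spaces.linear scale scale g"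
  shows "(\<Sum>b\<in>B. representation B (f (g b)) b) = (\<Sum>b\<in>B. representation B (g (f b)) b)"
  by (subst representation_linear[OF B B f], subst representation_linear[OF B B g], subst sum.swap)
    (simp add: mult.commute)

end

section \<open>The bracket and the invariance of the Killing form\<close>

context complex_lie_algebra
begin

lemma bracket_add_left: "bracket (x + y) z = bracket x z + bracket y z"
  and bracket_scale_left: "bracket (scale c x) z = scale c (bracket x z)"
  using linear_bracket_left[of z] by (simp_all add: Vector_Spaces.linear_iff)

lemma bracket_add_right: "bracket z (x + y) = bracket z x + bracket z y"
  and bracket_scale_right: "bracket z (scale c x) = scale c (bracket z x)"
  using linear_bracket_right[of z] by (simp_all add: Vector_Spaces.linear_iff)

lemma bracket_zero_left [simp]: "bracket 0 x = 0"
  using bracket_scale_left[of 0 0 x] by simp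

lemma bracket_zero_right [simp]: "bracket x 0 = 0"
  using bracket_scale_right[of x 0 0] by simp

lemma bracket_minus_right: "bracket x (- y) = - bracket x y"
  using bracket_scale_right[of x "-1" y] by simp

lemma bracket_diff_right: "bracket x (y - z) = bracket x y - bracket x z"
  using bracket_add_right[of x y "- z"] by (simp add: bracket_minus_right)

lemma bracket_anticommute: "bracket x y = - bracket y x"
proof -
  have "bracket (x + y) (x + y) = 0" by (rule bracket_self)
  hence "bracket x y + bracket y x = 0"
    unfolding bracket_add_left bracket_add_right by (simp add: bracket_self add.commute)
  hence "bracket y x + bracket x y = 0" by (simp add: add.commute)
  from minus_unique[OF this] show ?thesis by simp
qed

lemma bracket_bracket: "bracket (bracket x y) z = bracket x (bracket y z) - bracket y (bracket x z)"
proof -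
  have "bracket (bracket x y) z = - bracket z (bracket x y)" by (rule bracket_anticommute)
  also have "bracket z (bracket x y) = - (bracket x (bracket y z) + bracket y (bracket z x))"
    by (rule minus_unique[OF jacobi, symmetric])
  also have "bracket z x = - bracket x z" by (rule bracket_anticommute)
  finally show ?thesis by (simp add: bracket_minus_right)
qed

lemma bracket_swap: "bracket x (bracket y z) = bracket (bracket x y) z + bracket y (bracket x z)"
  by (simp add: bracket_bracket)

lemma linear_bracket_bracket: "Vector_Spaces.linear scale scale (\<lambda>z. bracket x (bracket y z))"
  using linear_bracket_right[of x] linear_bracket_right[of y]
  by (simp add: Vector_Spaces.linear_iff)

lemma endo_trace_commute:
  "Vector_Spaces.linear scale scale f \<Longrightarrow> Vector_Spaces.linear scale scale g \<Longrightarrow>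
    endo_trace (\<lambda>x. f (g x)) = endo_trace (\<lambda>x. g (f x))"
  unfolding endo_trace_def by (rule trace_commute[OF independent_Basis span_Basis])

lemma endo_trace_basis:
  "independent C \<Longrightarrow> span C = UNIV \<Longrightarrow> Vector_Spaces.linear scale scale f \<Longrightarrow>
    endo_trace f = (\<Sum>c\<in>C. representation C (f c) c)"
  unfolding endo_trace_def by (rule trace_basis_independent[OF independent_Basis span_Basis])

lemma endo_trace_add: "endo_trace (\<lambda>x. f x + g x) = endo_trace f + endo_trace g"
  by (simp add: endo_trace_def representation_add independent_Basis span_Basis sum.distrib)

lemma endo_trace_diff: "endo_trace (\<lambda>x. f x - g x) = endo_trace f - endo_trace g"
  by (simp add: endo_trace_def representation_diff independent_Basis span_Basis sum_subtractf)

lemma endo_trace_scale: "endo_trace (\<lambda>x. scale c (f x)) = c * endo_trace f"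
  by (simp add: endo_trace_def representation_scale independent_Basis span_Basis sum_distrib_left)

lemma killing_commute: "killing x y = killing y x"
  unfolding killing_def by (intro endo_trace_commute linear_bracket_right)

lemma killing_add_left: "killing (x + y) z = killing x z + killing y z"
  by (simp add: killing_def bracket_add_left endo_trace_add)

lemma killing_scale_left: "killing (scale c x) z = c * killing x z"
  by (simp add: killing_def bracket_scale_left endo_trace_scale)

lemma killing_add_right: "killing z (x + y) = killing z x + killing z y"
  by (simp add: killing_commute[of z] killing_add_left)

lemma killing_scale_right: "killing z (scale c x) = c * killing z x"
  by (simp add: killing_commute[of z] killing_scale_left)

lemma killing_zero_left [simp]: "killing 0 x = 0"
  using killing_scale_left[of 0 0 x] by simp

lemma killing_zero_right [simp]: "killing x 0 = 0"
  using killing_scale_right[of x 0 0] by simp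

lemma killing_invariant: "killing (bracket x y) z = killing x (bracket y z)"
proof -
  have lin: "Vector_Spaces.linear scale scale (\<lambda>u. bracket x (bracket z u))"
    by (rule linear_bracket_bracket)
  have "killing (bracket x y) z = endo_trace (\<lambda>u. bracket x (bracket y (bracket z u)))
      - endo_trace (\<lambda>u. bracket y (bracket x (bracket z u)))"
    by (simp add: killing_def bracket_bracket endo_trace_diff)
  also have "endo_trace (\<lambda>u. bracket y (bracket x (bracket z u)))
      = endo_trace (\<lambda>u. bracket x (bracket z (bracket y u)))"
    by (rule endo_trace_commute[OF linear_bracket_right lin])
  also have "endo_trace (\<lambda>u. bracket x (bracket y (bracket z u))) - \<dots> = killing x (bracket y z)"
    by (simp add: killing_def bracket_bracket bracket_diff_right endo_trace_diff)
  finally show ?thesis .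
qed

end

section \<open>Root spaces and root strings\<close>

context simple_lie_algebra_with_cartan
begin

lemma h_subspace: "subspace h"
  using cartan by (simp add: cartan_subalgebra_def abelian_subalgebra_def)

lemma h_abelian: "x \<in> h \<Longrightarrow> y \<in> h \<Longrightarrow> bracket x y = 0"
  using cartan by (simp add: cartan_subalgebra_def abelian_subalgebra_def)

lemma h_maximal: "abelian_subalgebra a \<Longrightarrow> h \<subseteq> a \<Longrightarrow> a = h"
  using cartan by (simp add: cartan_subalgebra_def)

lemma span_eigenvectors: "H \<in> h \<Longrightarrow> span {x. \<exists>c. bracket H x = scale c x} = UNIV"
  using cartan by (simp add: cartan_subalgebra_def semisimple_endo_def)

lemma subspace_root_space: "subspace (root_space \<phi>)"
  by (rule subspaceI) (simp_all add: root_space_def bracket_add_right bracket_scale_right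
      scale_right_distrib mult.commute)

lemma root_spaceD: "x \<in> root_space \<phi> \<Longrightarrow> H \<in> h \<Longrightarrow> bracket H x = scale (\<phi> H) x"
  by (simp add: root_space_def)

lemma bracket_root_space:
  "x \<in> root_space \<phi> \<Longrightarrow> y \<in> root_space \<psi> \<Longrightarrow> bracket x y \<in> root_space (\<phi> + \<psi>)"
  by (simp add: root_space_def bracket_swap[of _ x y] bracket_scale_left bracket_scale_right
      scale_left_distrib)

text \<open>An element commuting with \<open>h\<close> spans, together with \<open>h\<close>, an
  abelian subalgebra, so maximality of \<open>h\<close> absorbs it.\<close>

lemma root_space_0: "root_space 0 = h"
proof
  show "h \<subseteq> root_space 0" by (auto simp: root_space_def h_abelian)
  show "root_space 0 \<subseteq> h"
  proof
    fix x assume x: "x \<in> root_space 0"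
    hence hx: "bracket H x = 0" "bracket x H = 0" if "H \<in> h" for H
      using that bracket_anticommute[of x H] by (auto simp: root_space_def)
    have "abelian_subalgebra (span (insert x h))"
      unfolding abelian_subalgebra_def
    proof (intro conjI ballI)
      fix u v assume "u \<in> span (insert x h)" "v \<in> span (insert x h)"
      then obtain k l where kl: "u - scale k x \<in> h" "v - scale l x \<in> h"
        using span_eq_iff[THEN iffD2, OF h_subspace] by (auto simp: span_breakdown_eq)
      have "bracket u v = bracket ((u - scale k x) + scale k x) ((v - scale l x) + scale l x)" by simp
      also have "\<dots> = 0"
        unfolding bracket_add_left bracket_add_right bracket_scale_left bracket_scale_right
        using kl by (simp add: h_abelian hx bracket_self)
      finally show "bracket u v = 0" .
    qed simp
    moreover have "h \<subseteq> span (insert x h)" by (meson span_superset subset_insertI subset_trans)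
    ultimately have "span (insert x h) = h" by (rule h_maximal)
    thus "x \<in> h" by (metis insertI1 span_base)
  qed
qed

lemma dual_0: "0 \<in> dual"
  by (simp add: dual_def)

lemma dual_add: "\<phi> \<in> dual \<Longrightarrow> \<psi> \<in> dual \<Longrightarrow> \<phi> + \<psi> \<in> dual"
  by (auto simp: dual_def algebra_simps)

lemma dual_rscale: "\<phi> \<in> dual \<Longrightarrow> rscale r \<phi> \<in> dual"
  by (auto simp: dual_def rscale_def algebra_simps)

lemma dual_uminus: "\<phi> \<in> dual \<Longrightarrow> - \<phi> \<in> dual"
  by (auto simp: dual_def algebra_simps)

lemma dual_nonzero: "\<phi> \<in> dual \<Longrightarrow> \<phi> \<noteq> 0 \<Longrightarrow> \<exists>H\<in>h. \<phi> H \<noteq> 0"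
  by (auto simp: dual_def fun_eq_iff)

lemma dual_h: "\<phi> \<in> dual \<Longrightarrow> x \<in> h \<Longrightarrow> \<phi> (scale c x) = c * \<phi> x"
  "\<phi> \<in> dual \<Longrightarrow> x \<in> h \<Longrightarrow> y \<in> h \<Longrightarrow> \<phi> (x + y) = \<phi> x + \<phi> y"
  by (auto simp: dual_def)

lemma rootsD: "\<alpha> \<in> roots \<Longrightarrow> \<alpha> \<in> dual" "\<alpha> \<in> roots \<Longrightarrow> \<alpha> \<noteq> 0"
  by (auto simp: roots_def)

lemma simultaneous_eigenvector_root_space:
  assumes x: "x \<noteq> 0" and ev: "\<And>H. H \<in> h \<Longrightarrow> \<exists>c. bracket H x = scale c x"
  shows "\<exists>\<phi>\<in>dual. x \<in> root_space \<phi>"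
proof -
  from ev obtain c where c: "\<And>H. H \<in> h \<Longrightarrow> bracket H x = scale (c H) x" by metis
  define \<phi> where "\<phi> H = (if H \<in> h then c H else 0)" for H
  have "c (H + K) = c H + c K" if "H \<in> h" "K \<in> h" for H K
  proof -
    have "scale (c (H + K)) x = scale (c H + c K) x"
      using c[of "H + K"] c[OF that(1)] c[OF that(2)] that h_subspace
      by (simp add: bracket_add_left scale_left_distrib subspace_add)
    thus ?thesis using x by simp
  qed
  moreover have "c (scale a H) = a * c H" if "H \<in> h" for a H
  proof -
    have "scale (c (scale a H)) x = bracket (scale a H) x"
      using c[of "scale a H"] that h_subspace by (simp add: subspace_scale)
    also have "\<dots> = scale (a * c H) x" using c[OF that] by (simp add: bracket_scale_left)
    finally show ?thesis using x by simp
  qed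
  ultimately have "\<phi> \<in> dual"
    using h_subspace by (auto simp: dual_def \<phi>_def subspace_add subspace_scale)
  moreover have "x \<in> root_space \<phi>" by (simp add: root_space_def \<phi>_def c)
  ultimately show ?thesis by blast
qed

text \<open>Simultaneous diagonalization needs finitely many operators, so it is applied to a basis
  of \<open>h\<close>; its common eigenvectors are eigenvectors for all of \<open>h\<close> by
  linearity.\<close>

lemma ex_eigenbasis:
  "\<exists>C wt. independent C \<and> span C = UNIV \<and> finite C \<and> (\<forall>b\<in>C. wt b \<in> dual \<and> b \<in> root_space (wt b))"
proof -
  let ?S = "{x. \<forall>H\<in>h. \<exists>c. bracket H x = scale c x}"
  obtain F where F: "F \<subseteq> h" "independent F" "h \<subseteq> span F"
    by (metis maximal_independent_subset)
  have "span {x. \<forall>H\<in>F. \<exists>c. bracket H x = scale c x} = UNIV"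
  proof (rule span_simultaneous_eigenvectors)
    show "finite F" using F finiteI_independent by blast
    show "bracket H (bracket K x) = bracket K (bracket H x)" if "H \<in> F" "K \<in> F" for H K x
    proof -
      have "bracket H K = 0" using that F by (intro h_abelian) auto
      with bracket_swap[of H K x] show ?thesis by simp
    qed
  qed (use F linear_bracket_right span_eigenvectors in auto)
  moreover have "{x. \<forall>H\<in>F. \<exists>c. bracket H x = scale c x} \<subseteq> ?S"
  proof safe
    fix x H assume x: "\<forall>H\<in>F. \<exists>c. bracket H x = scale c x" and H: "H \<in> h"
    have "subspace {H. \<exists>c. bracket H x = scale c x}"
    proof (rule subspaceI)
      show "0 \<in> {H. \<exists>c. bracket H x = scale c x}" by (auto intro: exI[of _ 0])
      fix H K a
      assume H: "H \<in> {H. \<exists>c. bracket H x = scale c x}"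
      then obtain c where c: "bracket H x = scale c x" by blast
      show "scale a H \<in> {H. \<exists>c. bracket H x = scale c x}" by (auto simp: bracket_scale_left c)
      assume "K \<in> {H. \<exists>c. bracket H x = scale c x}"
      then obtain d where "bracket K x = scale d x" by blast
      hence "bracket (H + K) x = scale (c + d) x" by (simp add: bracket_add_left c scale_left_distrib)
      thus "H + K \<in> {H. \<exists>c. bracket H x = scale c x}" by blast
    qed
    with x have "span F \<subseteq> {H. \<exists>c. bracket H x = scale c x}" by (intro span_minimal) auto
    with F H show "\<exists>c. bracket H x = scale c x" by auto
  qed
  ultimately have S: "span ?S = UNIV" using span_mono by blast
  obtain C where C: "C \<subseteq> ?S" "independent C" "?S \<subseteq> span C"
    by (rule maximal_independent_subset[of ?S])
  have "span C = UNIV" using span_minimal[OF C(3) subspace_span] S by auto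
  have "\<forall>b\<in>C. \<exists>\<phi>\<in>dual. b \<in> root_space \<phi>"
  proof
    fix b assume b: "b \<in> C"
    hence "b \<noteq> 0" using C(2) dependent_zero by metis
    thus "\<exists>\<phi>\<in>dual. b \<in> root_space \<phi>" using C(1) b by (intro simultaneous_eigenvector_root_space) auto
  qed
  hence "\<exists>wt. \<forall>b\<in>C. wt b \<in> dual \<and> b \<in> root_space (wt b)" by metis
  with C(2) \<open>span C = UNIV\<close> finiteI_independent show ?thesis by blast
qed

lemma root_spaceI_roots: "\<phi> \<in> dual \<Longrightarrow> x \<in> root_space \<phi> \<Longrightarrow> x \<noteq> 0 \<Longrightarrow> \<phi> = 0 \<or> \<phi> \<in> roots"
  by (auto simp: roots_def)

text \<open>Serves as an induction principle: a linear condition has to be checked on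
  \<open>h\<close> and on root vectors only.\<close>

lemma root_decomposition:
  assumes S: "subspace S" "h \<subseteq> S" "\<And>\<alpha>. \<alpha> \<in> roots \<Longrightarrow> root_space \<alpha> \<subseteq> S"
  shows "x \<in> S"
proof -
  obtain C wt where C: "span C = UNIV" "\<And>b. b \<in> C \<Longrightarrow> wt b \<in> dual" "\<And>b. b \<in> C \<Longrightarrow> b \<in> root_space (wt b)"
    using ex_eigenbasis by blast
  have "b \<in> S" if "b \<in> C" for b
  proof (cases "b = 0")
    case False
    hence "wt b = 0 \<or> wt b \<in> roots" using C that by (intro root_spaceI_roots)
    thus ?thesis using S C(3)[OF that] root_space_0 by auto
  qed (use S subspace_0 in auto)
  hence "span C \<subseteq> S" using S by (intro span_minimal) auto
  with C show ?thesis by auto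
qed

lemma center_trivial:
  assumes "\<And>y. bracket x y = 0"
  shows "x = 0"
proof -
  let ?Z = "{x. \<forall>y. bracket x y = 0}"
  have "lie_ideal ?Z"
    unfolding lie_ideal_def
  proof (intro conjI allI ballI)
    show "subspace ?Z" by (rule subspaceI) (simp_all add: bracket_add_left bracket_scale_left)
    show "bracket u v \<in> ?Z" if "v \<in> ?Z" for u v
      using that bracket_anticommute[of u v] by simp
  qed
  from simple[OF this] assms nonabelian show ?thesis by blast
qed

lemma h_eq_0I:
  assumes "H \<in> h" "\<And>\<beta>. \<beta> \<in> roots \<Longrightarrow> \<beta> H = 0"
  shows "H = 0"
proof (rule center_trivial)
  fix y
  have "y \<in> {y. bracket H y = 0}"
  proof (rule root_decomposition)
    show "subspace {y. bracket H y = 0}"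
      by (rule subspaceI) (simp_all add: bracket_add_right bracket_scale_right)
  qed (use assms h_abelian in \<open>auto simp: root_spaceD\<close>)
  thus "bracket H y = 0" by simp
qed

section \<open>Root strings\<close>

lemma funpow_bracket_root_space:
  assumes "x \<in> root_space \<alpha>" "v \<in> root_space \<beta>"
  shows "(bracket x ^^ k) v \<in> root_space (\<beta> + rscale (real k) \<alpha>)"
proof (induction k)
  case (Suc k)
  have "\<alpha> + (\<beta> + rscale (real k) \<alpha>) = \<beta> + rscale (real (Suc k)) \<alpha>"
    by (simp add: rscale_def fun_eq_iff algebra_simps)
  with bracket_root_space[OF assms(1) Suc] show ?case by (simp only: funpow.simps comp_apply)
qed (use assms in \<open>simp add: rscale_def fun_eq_iff plus_fun_def\<close>)

text \<open>Otherwise the string would consist of eigenvectors of \<open>bracket H\<close> for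
  infinitely many distinct eigenvalues, all linearly independent.\<close>

lemma root_string_finite:
  assumes x: "x \<in> root_space \<alpha>" and v: "v \<in> root_space \<beta>" and H: "H \<in> h" "\<alpha> H \<noteq> 0"
  shows "\<exists>k. (bracket x ^^ k) v = 0"
proof (rule ccontr)
  assume nz: "\<nexists>k. (bracket x ^^ k) v = 0"
  let ?c = "\<lambda>k::nat. \<beta> H + of_nat k * \<alpha> H"
  have "inj ?c" using H by (auto intro!: injI)
  have ev: "bracket H ((bracket x ^^ k) v) = scale (?c k) ((bracket x ^^ k) v)" for k
    using root_spaceD[OF funpow_bracket_root_space[OF x v] H(1)] by (simp add: rscale_def)
  note ind = independent_distinct_eigenvectors[OF linear_bracket_right \<open>inj ?c\<close> _ ev]
  have "finite (range (\<lambda>k. (bracket x ^^ k) v))" "inj (\<lambda>k. (bracket x ^^ k) v)"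
    using ind nz finiteI_independent by blast+
  thus False using finite_imageD infinite_UNIV_nat by blast
qed

text \<open>This covers \<open>sl\<^sub>2\<close> (\<open>a = 2\<close>) and, to rule it out for roots, the Heisenberg algebra (\<open>a = 0\<close>).\<close>

lemma lowering_string:
  assumes e: "e \<in> root_space \<alpha>" and f: "f \<in> root_space (- \<alpha>)" and v: "v \<in> root_space \<beta>"
    and ev: "bracket e v = 0" and h: "bracket e f \<in> h"
  defines "a \<equiv> \<alpha> (bracket e f)" and "M \<equiv> \<beta> (bracket e f)"
  shows "bracket e ((bracket f ^^ Suc k) v)
    = scale (of_nat (Suc k) * (M - a * of_nat k / 2)) ((bracket f ^^ k) v)"
proof (induction k)
  case 0
  show ?case using bracket_swap[of e f v] ev root_spaceD[OF v h] by (simp add: M_def)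
next
  case (Suc k)
  let ?u = "(bracket f ^^ Suc k) v"
  have "bracket (bracket e f) ?u = scale (M - of_nat (Suc k) * a) ?u"
    using root_spaceD[OF funpow_bracket_root_space[OF f v] h, of "Suc k"]
    by (simp add: rscale_def M_def a_def)
  hence "bracket e (bracket f ?u) = scale (M - of_nat (Suc k) * a) ?u
      + bracket f (scale (of_nat (Suc k) * (M - a * of_nat k / 2)) ((bracket f ^^ k) v))"
    unfolding bracket_swap[of e f ?u] Suc by simp
  also have "\<dots> = scale (M - of_nat (Suc k) * a + of_nat (Suc k) * (M - a * of_nat k / 2)) ?u"
    by (simp add: bracket_scale_right scale_left_distrib)
  also have "M - of_nat (Suc k) * a + of_nat (Suc k) * (M - a * of_nat k / 2)
      = of_nat (Suc (Suc k)) * (M - a * of_nat (Suc k) / 2)"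
    by (simp add: field_simps)
  finally show ?case by simp
qed

text \<open>Raise \<open>v\<close> by \<open>e\<close> as long as it stays nonzero (\<open>p\<close>
  times), then lower by \<open>f\<close> as long as possible (\<open>N\<close> times). Since one
  more lowering gives 0, the coefficient in \<open>lowering_string\<close> at \<open>N\<close> must
  vanish, which is the stated relation. Leaving \<open>\<alpha> (bracket e f)\<close> unnormalized
  admits the value 0.\<close>

lemma root_string:
  assumes \<alpha>: "\<alpha> \<in> dual" "\<alpha> \<noteq> 0" and e: "e \<in> root_space \<alpha>" and f: "f \<in> root_space (- \<alpha>)"
    and v: "v \<in> root_space \<beta>" "v \<noteq> 0"
  shows "\<exists>p N :: nat. 2 * (\<beta> (bracket e f) + of_nat p * \<alpha> (bracket e f)) = \<alpha> (bracket e f) * of_nat N \<and>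
    (\<forall>i\<le>N. (bracket f ^^ i) ((bracket e ^^ p) v) \<noteq> 0)"
proof -
  let ?H = "bracket e f"
  have H: "?H \<in> h" using bracket_root_space[OF e f] root_space_0 by simp
  obtain K where K: "K \<in> h" "\<alpha> K \<noteq> 0" using dual_nonzero \<alpha> by blast
  define q where "q = (LEAST k. (bracket e ^^ k) v = 0)"
  have q: "(bracket e ^^ q) v = 0"
    unfolding q_def using root_string_finite[OF e v(1) K] by (rule LeastI_ex)
  have qmin: "(bracket e ^^ k) v \<noteq> 0" if "k < q" for k
    using not_less_Least that unfolding q_def by blast
  from q v obtain p where p: "q = Suc p" by (cases q) auto
  define u where "u = (bracket e ^^ p) v"
  have u: "u \<noteq> 0" "bracket e u = 0" "u \<in> root_space (\<beta> + rscale (real p) \<alpha>)"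
    using qmin[of p] q p funpow_bracket_root_space[OF e v(1)] by (auto simp: u_def)
  define m where "m = (LEAST k. (bracket f ^^ k) u = 0)"
  have "(- \<alpha>) K \<noteq> 0" using K by simp
  from root_string_finite[OF f u(3) K(1) this] have m: "(bracket f ^^ m) u = 0"
    unfolding m_def by (rule LeastI_ex)
  have mmin: "(bracket f ^^ k) u \<noteq> 0" if "k < m" for k
    using not_less_Least that unfolding m_def by blast
  from m u obtain N where N: "m = Suc N" by (cases m) auto
  have "scale (of_nat (Suc N) * ((\<beta> + rscale (real p) \<alpha>) ?H - \<alpha> ?H * of_nat N / 2)) ((bracket f ^^ N) u) = 0"
    using lowering_string[OF e f u(3) u(2) H, of N] m N by simp
  hence "(of_nat (Suc N) :: complex) * ((\<beta> + rscale (real p) \<alpha>) ?H - \<alpha> ?H * of_nat N / 2) = 0"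
    using mmin[of N] N by simp
  hence "(\<beta> + rscale (real p) \<alpha>) ?H - \<alpha> ?H * of_nat N / 2 = 0" using of_nat_neq_0 by (metis mult_eq_0_iff)
  hence "2 * (\<beta> ?H + of_nat p * \<alpha> ?H) = \<alpha> ?H * of_nat N" by (simp add: rscale_def field_simps)
  moreover have "(bracket f ^^ i) ((bracket e ^^ p) v) \<noteq> 0" if "i \<le> N" for i
    using mmin[of i] N that by (simp add: u_def)
  ultimately show ?thesis by blast
qed

text \<open>With \<open>\<alpha> (bracket e f) = 0\<close> the relation of
  \<open>root_string\<close> says that every root vanishes on \<open>bracket e f\<close>.\<close>

lemma bracket_opposite_eq_0:
  assumes \<alpha>: "\<alpha> \<in> roots" and e: "e \<in> root_space \<alpha>" and f: "f \<in> root_space (- \<alpha>)"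
    and a: "\<alpha> (bracket e f) = 0"
  shows "bracket e f = 0"
proof (rule h_eq_0I)
  show "bracket e f \<in> h" using bracket_root_space[OF e f] root_space_0 by simp
  fix \<beta> assume "\<beta> \<in> roots"
  then obtain v where "v \<in> root_space \<beta>" "v \<noteq> 0"
    using subspace_0[OF subspace_root_space] by (fastforce simp: roots_def)
  from root_string[OF rootsD[OF \<alpha>] e f this] a show "\<beta> (bracket e f) = 0" by auto
qed

text \<open>The relation of \<open>root_string\<close> becomes
  \<open>\<beta> (bracket e f) = N - 2p\<close>. If this is nonnegative, then \<open>p\<close> is at
  most \<open>N\<close>, and lowering the top vector \<open>N - p\<close> times lands in the
  reflected weight space.\<close>

lemma string_integral_upper:
  assumes \<alpha>: "\<alpha> \<in> dual" "\<alpha> \<noteq> 0" and e: "e \<in> root_space \<alpha>" and f: "f \<in> root_space (- \<alpha>)"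
    and a: "\<alpha> (bracket e f) = 2" and v: "v \<in> root_space \<beta>" "v \<noteq> 0"
  shows "\<exists>n :: int. \<beta> (bracket e f) = of_int n \<and>
    (n \<ge> 0 \<longrightarrow> (\<exists>u\<in>root_space (\<beta> - rscale (of_int n) \<alpha>). u \<noteq> 0))"
proof -
  obtain p N :: nat where pN: "2 * (\<beta> (bracket e f) + of_nat p * \<alpha> (bracket e f)) = \<alpha> (bracket e f) * of_nat N"
    and nz: "\<forall>i\<le>N. (bracket f ^^ i) ((bracket e ^^ p) v) \<noteq> 0"
    using root_string[OF \<alpha> e f v] by blast
  from pN have "2 * (\<beta> (bracket e f) + 2 * of_nat p) = 2 * of_nat N" by (simp add: a mult.commute)
  hence "\<beta> (bracket e f) + 2 * of_nat p = of_nat N" by (subst (asm) mult_cancel_left) simp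
  hence n: "\<beta> (bracket e f) = of_int (int N - 2 * int p)" by (simp add: eq_diff_eq)
  show ?thesis
  proof (intro exI[of _ "int N - 2 * int p"] conjI impI)
    show "\<beta> (bracket e f) = of_int (int N - 2 * int p)" by (rule n)
  next
    assume "int N - 2 * int p \<ge> 0"
    hence le: "p \<le> N" by linarith
    have "(bracket f ^^ (N - p)) ((bracket e ^^ p) v)
        \<in> root_space (\<beta> + rscale (real p) \<alpha> + rscale (real (N - p)) (- \<alpha>))"
      by (intro funpow_bracket_root_space e f v)
    also have "\<beta> + rscale (real p) \<alpha> + rscale (real (N - p)) (- \<alpha>)
        = \<beta> - rscale (of_int (int N - 2 * int p)) \<alpha>"
      using le by (simp add: rscale_def fun_eq_iff of_nat_diff algebra_simps)
    finally have "(bracket f ^^ (N - p)) ((bracket e ^^ p) v)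
      \<in> root_space (\<beta> - rscale (of_int (int N - 2 * int p)) \<alpha>)" .
    moreover have "(bracket f ^^ (N - p)) ((bracket e ^^ p) v) \<noteq> 0" using nz by simp
    ultimately show "\<exists>u\<in>root_space (\<beta> - rscale (of_int (int N - 2 * int p)) \<alpha>). u \<noteq> 0"
      by blast
  qed
qed

lemma string_integral:
  assumes \<alpha>: "\<alpha> \<in> dual" "\<alpha> \<noteq> 0" and e: "e \<in> root_space \<alpha>" and f: "f \<in> root_space (- \<alpha>)"
    and a: "\<alpha> (bracket e f) = 2" and v: "v \<in> root_space \<beta>" "v \<noteq> 0" and \<beta>: "\<beta> \<in> dual"
  shows "\<exists>n :: int. \<beta> (bracket e f) = of_int n \<and> (\<exists>u\<in>root_space (\<beta> - rscale (of_int n) \<alpha>). u \<noteq> 0)"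
proof -
  obtain n :: int where n: "\<beta> (bracket e f) = of_int n"
    "n \<ge> 0 \<longrightarrow> (\<exists>u\<in>root_space (\<beta> - rscale (of_int n) \<alpha>). u \<noteq> 0)"
    using string_integral_upper[OF \<alpha> e f a v] by (elim exE conjE)
  show ?thesis
  proof (cases "n \<ge> 0")
    case True
    with n show ?thesis by blast
  next
    \<comment> \<open>Exchanging \<open>e\<close> and \<open>f\<close> replaces
      \<open>\<alpha>\<close> by \<open>- \<alpha>\<close> and \<open>n\<close> by
      \<open>- n\<close>, with the same reflected weight.\<close>
    case False
    have H: "bracket e f \<in> h" using bracket_root_space[OF e f] root_space_0 by simp
    have fe: "bracket f e = scale (-1) (bracket e f)" using bracket_anticommute[of f e] by simp
    have neg: "- \<alpha> \<in> dual" "- \<alpha> \<noteq> 0" "e \<in> root_space (- (- \<alpha>))"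
      using dual_uminus \<alpha> e by simp_all
    have "(- \<alpha>) (bracket f e) = 2" using dual_h(1)[OF \<alpha>(1) H, of "-1"] a fe by simp
    from string_integral_upper[OF neg(1,2) f neg(3) this v]
    obtain m :: int where m: "\<beta> (bracket f e) = of_int m"
      "m \<ge> 0 \<longrightarrow> (\<exists>u\<in>root_space (\<beta> - rscale (of_int m) (- \<alpha>)). u \<noteq> 0)" by (elim exE conjE)
    have "\<beta> (bracket f e) = - \<beta> (bracket e f)" using dual_h(1)[OF \<beta> H, of "-1"] fe by simp
    hence "(of_int m :: complex) = of_int (- n)" using m(1) n(1) by simp
    hence "m = - n" by (simp only: of_int_eq_iff)
    moreover have "\<beta> - rscale (of_int (- n)) (- \<alpha>) = \<beta> - rscale (of_int n) \<alpha>"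
      by (simp add: rscale_def fun_eq_iff)
    ultimately show ?thesis using m(2) False n(1) by auto
  qed
qed

end

section \<open>Nondegeneracy and the root system\<close>

context simple_lie_algebra_with_cartan
begin

text \<open>Some \<open>H\<close> separates the two weights; computing the
  \<open>b\<close>-coordinate of \<open>bracket H x\<close> in two ways makes it vanish.\<close>

lemma eigenbasis_representation_eq_0:
  assumes C: "independent C" "span C = UNIV" "finite C" "\<forall>b\<in>C. wt b \<in> dual \<and> b \<in> root_space (wt b)"
    and x: "x \<in> root_space \<phi>" "\<phi> \<in> dual" and b: "b \<in> C" "wt b \<noteq> \<phi>"
  shows "representation C x b = 0"
proof -
  have "wt b \<in> dual" using C b by blast
  hence "wt b - \<phi> \<in> dual" using dual_add[OF _ dual_uminus[OF x(2)], of "wt b"] by simp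
  then obtain H where H: "H \<in> h" "(wt b - \<phi>) H \<noteq> 0"
    using dual_nonzero b(2) by (metis right_minus_eq)
  have "bracket H x = (\<Sum>c\<in>C. scale (representation C x c) (bracket H c))"
  proof -
    interpret l: Vector_Spaces.linear scale scale "bracket H" by (rule linear_bracket_right)
    have "bracket H x = bracket H (\<Sum>c\<in>C. scale (representation C x c) c)"
      using C by (simp add: sum_representation_eq)
    thus ?thesis by (simp add: l.sum l.scale)
  qed
  also have "\<dots> = (\<Sum>c\<in>C. scale (representation C x c * wt c H) c)"
    using C(4) H root_spaceD by (intro sum.cong) auto
  finally have "representation C (bracket H x) b = (\<Sum>c\<in>C. representation C x c * wt c H * representation C c b)"
    using C(1,2) by (simp add: representation_sum representation_scale)
  also have "\<dots> = (\<Sum>c\<in>C. if c = b then representation C x c * wt c H else 0)"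
    using C(1) by (intro sum.cong) (auto simp: representation_basis)
  also have "\<dots> = representation C x b * wt b H" using C(3) b by simp
  finally have "\<phi> H * representation C x b = representation C x b * wt b H"
    using root_spaceD[OF x(1) H(1)] C(1,2) by (simp add: representation_scale)
  thus ?thesis using H(2) by (simp add: mult.commute)
qed

lemma killing_eigenbasis:
  assumes C: "independent C" "span C = UNIV" "finite C" "\<forall>b\<in>C. wt b \<in> dual \<and> b \<in> root_space (wt b)"
    and H: "H \<in> h" "H' \<in> h"
  shows "killing H H' = (\<Sum>b\<in>C. wt b H * wt b H')"
proof -
  have "killing H H' = (\<Sum>b\<in>C. representation C (bracket H (bracket H' b)) b)"
    unfolding killing_def by (rule endo_trace_basis[OF C(1,2) linear_bracket_bracket])
  also have "\<dots> = (\<Sum>b\<in>C. wt b H * wt b H')"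
  proof (rule sum.cong)
    fix b assume b: "b \<in> C"
    hence "bracket H (bracket H' b) = scale (wt b H' * wt b H) b"
      using C(4) H root_spaceD[of b "wt b"] by (auto simp: bracket_scale_right)
    thus "representation C (bracket H (bracket H' b)) b = wt b H * wt b H'"
      using C b by (simp add: representation_scale representation_basis)
  qed simp
  finally show ?thesis .
qed

text \<open>In an eigenbasis \<open>killing H H\<close> is a sum of squares of integers; if all were
  0, \<open>H\<close> would be central.\<close>

lemma killing_integral_pos:
  assumes H: "H \<in> h" "H \<noteq> 0" and int: "\<And>\<beta>. \<beta> \<in> roots \<Longrightarrow> \<beta> H \<in> \<int>"
  shows "\<exists>r>0. killing H H = complex_of_real r"
proof -
  obtain C wt where C: "independent C" "span C = UNIV" "finite C"
      "\<forall>b\<in>C. wt b \<in> dual \<and> b \<in> root_space (wt b)"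
    using ex_eigenbasis by blast
  have "\<exists>n :: int. wt b H = of_int n" if "b \<in> C" for b
  proof -
    have "b \<noteq> 0" using that C(1) dependent_zero by metis
    with C(4) that have "wt b = 0 \<or> wt b \<in> roots" by (intro root_spaceI_roots) auto
    thus ?thesis using int by (auto elim!: Ints_cases intro: exI[of _ 0])
  qed
  then obtain n :: "'a \<Rightarrow> int" where n: "\<And>b. b \<in> C \<Longrightarrow> wt b H = of_int (n b)" by metis
  have K: "killing H H = complex_of_real (\<Sum>b\<in>C. (of_int (n b))\<^sup>2)"
    unfolding killing_eigenbasis[OF C H(1) H(1)] by (simp add: n power2_eq_square)
  have "\<exists>b\<in>C. n b \<noteq> 0"
  proof (rule ccontr)
    assume "\<not> ?thesis"
    hence "bracket H b = 0" if "b \<in> C" for b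
      using C(4) that H n root_spaceD[of b "wt b" H] by auto
    moreover have "subspace {y. bracket H y = 0}"
      by (rule subspaceI) (simp_all add: bracket_add_right bracket_scale_right)
    ultimately have "span C \<subseteq> {y. bracket H y = 0}" by (intro span_minimal) auto
    with C(2) have "bracket H y = 0" for y by auto
    hence "H = 0" by (rule center_trivial)
    with H show False by simp
  qed
  then obtain b where b: "b \<in> C" "n b \<noteq> 0" by blast
  have "0 < (real_of_int (n b))\<^sup>2" using b by simp
  also have "\<dots> \<le> (\<Sum>b\<in>C. (real_of_int (n b))\<^sup>2)"
    using b C(3) by (intro member_le_sum) auto
  finally show ?thesis using K by blast
qed

lemma coroot_element:
  assumes \<alpha>: "\<alpha> \<in> roots" and e: "e \<in> root_space \<alpha>" and f: "f \<in> root_space (- \<alpha>)"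
    and ef: "\<alpha> (bracket e f) \<noteq> 0"
  obtains g where "g \<in> root_space (- \<alpha>)" "\<alpha> (bracket e g) = 2" "bracket e g \<in> h"
proof -
  have H: "bracket e f \<in> h" using bracket_root_space[OF e f] root_space_0 by simp
  define g where "g = scale (2 / \<alpha> (bracket e f)) f"
  have "g \<in> root_space (- \<alpha>)" unfolding g_def by (rule subspace_scale[OF subspace_root_space f])
  moreover have "\<alpha> (bracket e g) = 2"
    using dual_h(1)[OF rootsD(1)[OF \<alpha>] H] ef by (simp add: g_def bracket_scale_right)
  moreover have "bracket e g \<in> h"
    unfolding g_def bracket_scale_right by (rule subspace_scale[OF h_subspace H])
  ultimately show ?thesis by (rule that)
qed

lemma coroot_element_integral:
  assumes \<alpha>: "\<alpha> \<in> roots" and e: "e \<in> root_space \<alpha>" and g: "g \<in> root_space (- \<alpha>)"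
    and 2: "\<alpha> (bracket e g) = 2" and \<beta>: "\<beta> \<in> roots"
  shows "\<exists>n :: int. \<beta> (bracket e g) = of_int n \<and> \<beta> - rscale (of_int n) \<alpha> \<in> roots"
proof -
  obtain v where v: "v \<in> root_space \<beta>" "v \<noteq> 0"
    using \<beta> subspace_0[OF subspace_root_space] by (fastforce simp: roots_def)
  obtain n :: int where n: "\<beta> (bracket e g) = of_int n"
    and ex: "\<exists>u\<in>root_space (\<beta> - rscale (of_int n) \<alpha>). u \<noteq> 0"
    using string_integral[OF rootsD[OF \<alpha>] e g 2 v rootsD(1)[OF \<beta>]] by (elim exE conjE)
  \<comment> \<open>The reflected weight could be 0 a priori. Then \<open>\<beta>\<close> would be
    \<open>n\<close> times \<open>\<alpha>\<close>, and evaluation at \<open>bracket e g\<close>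
    would give n = 2n.\<close>
  have "\<beta> - rscale (of_int n) \<alpha> \<noteq> 0"
  proof
    assume "\<beta> - rscale (of_int n) \<alpha> = 0"
    hence eq: "\<beta> = rscale (of_int n) \<alpha>" by simp
    hence "\<beta> (bracket e g) = of_int n * \<alpha> (bracket e g)" by (simp add: rscale_def)
    hence "\<beta> (bracket e g) = of_int n * 2" by (simp only: 2)
    with n have "n = 0" by simp
    with eq have "\<beta> = 0" by (simp add: rscale_def fun_eq_iff)
    with \<beta> rootsD show False by blast
  qed
  moreover have "\<beta> - rscale (of_int n) \<alpha> \<in> dual"
    using dual_add[OF rootsD(1)[OF \<beta>] dual_uminus[OF dual_rscale[OF rootsD(1)[OF \<alpha>]]]] by simp
  ultimately have "\<beta> - rscale (of_int n) \<alpha> \<in> roots" using ex by (auto simp: roots_def)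
  with n show ?thesis by blast
qed

lemma killing_nonzero: "\<exists>x y. killing x y \<noteq> 0"
proof (rule ccontr)
  assume K0: "\<nexists>x y. killing x y \<noteq> 0"
  have ef0: "bracket e f = 0" if \<alpha>: "\<alpha> \<in> roots" and e: "e \<in> root_space \<alpha>" and f: "f \<in> root_space (- \<alpha>)" for \<alpha> e f
  proof (rule bracket_opposite_eq_0[OF \<alpha> e f], rule ccontr)
    assume "\<alpha> (bracket e f) \<noteq> 0"
    then obtain g where g: "g \<in> root_space (- \<alpha>)" "\<alpha> (bracket e g) = 2" "bracket e g \<in> h"
      using coroot_element[OF \<alpha> e f] by blast
    have "bracket e g \<noteq> 0" using g(2) dual_h(1)[OF rootsD(1)[OF \<alpha>] g(3), of 0] by auto
    moreover have "\<beta> (bracket e g) \<in> \<int>" if "\<beta> \<in> roots" for \<beta>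
      using coroot_element_integral[OF \<alpha> e g(1,2) that] by (metis Ints_of_int)
    ultimately show False using killing_integral_pos[OF g(3)] K0 by (metis of_real_eq_0_iff less_irrefl)
  qed
  define n where "n = span (\<Union>\<alpha>\<in>roots. root_space \<alpha>)"
  have n: "subspace n" "\<And>\<alpha>. \<alpha> \<in> roots \<Longrightarrow> root_space \<alpha> \<subseteq> n"
    unfolding n_def by (auto intro: span_base)
  have sub: "bracket x y \<in> n" if y: "y \<in> n" and gen: "\<And>\<beta> z. \<beta> \<in> roots \<Longrightarrow> z \<in> root_space \<beta> \<Longrightarrow> bracket x z \<in> n" for x y
  proof -
    have "subspace {y. bracket x y \<in> n}"
      using n(1) by (intro subspaceI)
        (simp_all add: bracket_add_right bracket_scale_right subspace_add subspace_scale subspace_0)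
    hence "n \<subseteq> {y. bracket x y \<in> n}"
      unfolding n_def using gen by (intro span_minimal) (auto simp: n_def)
    with y show ?thesis by auto
  qed
  have "lie_ideal n"
    unfolding lie_ideal_def
  proof (intro conjI n allI ballI)
    fix x y assume y: "y \<in> n"
    have "x \<in> {x. bracket x y \<in> n}"
    proof (rule root_decomposition)
      show "subspace {x. bracket x y \<in> n}"
        using n(1) by (intro subspaceI)
          (simp_all add: bracket_add_left bracket_scale_left subspace_add subspace_scale subspace_0)
      show "h \<subseteq> {x. bracket x y \<in> n}"
      proof
        fix H assume H: "H \<in> h"
        have "bracket H z \<in> n" if "\<beta> \<in> roots" "z \<in> root_space \<beta>" for \<beta> z
          using that n root_spaceD[OF that(2) H] by (auto intro: subspace_scale)
        with y sub show "H \<in> {x. bracket x y \<in> n}" by blast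
      qed
      show "root_space \<alpha> \<subseteq> {x. bracket x y \<in> n}" if \<alpha>: "\<alpha> \<in> roots" for \<alpha>
      proof
        fix x assume x: "x \<in> root_space \<alpha>"
        have "bracket x z \<in> n" if \<beta>: "\<beta> \<in> roots" and z: "z \<in> root_space \<beta>" for \<beta> z
        proof (cases "bracket x z = 0")
          case True
          thus ?thesis using n(1) by (simp add: subspace_0)
        next
          case False
          have in_sp: "bracket x z \<in> root_space (\<alpha> + \<beta>)" by (rule bracket_root_space[OF x z])
          have "\<alpha> + \<beta> \<noteq> 0"
          proof
            assume "\<alpha> + \<beta> = 0"
            hence "\<beta> = - \<alpha>" by (simp add: eq_neg_iff_add_eq_0 add.commute)
            with ef0[OF \<alpha> x] z False show False by blast
          qed
          with in_sp False have "\<alpha> + \<beta> \<in> roots"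
            using dual_add[OF rootsD(1)[OF \<alpha>] rootsD(1)[OF \<beta>]] root_spaceI_roots by blast
          with in_sp n(2) show ?thesis by blast
        qed
        with y sub show "x \<in> {x. bracket x y \<in> n}" by blast
      qed
    qed
    thus "bracket x y \<in> n" by simp
  qed
  from simple[OF this] show False
  proof
    assume n0: "n = {0}"
    have "x \<in> h" for x
      by (rule root_decomposition) (use h_subspace n n0 subspace_0 in auto)
    with nonabelian h_abelian show False by blast
  next
    assume nU: "n = UNIV"
    obtain C wt where C: "independent C" "span C = UNIV" "finite C"
        "\<forall>b\<in>C. wt b \<in> dual \<and> b \<in> root_space (wt b)"
      using ex_eigenbasis by blast
    \<comment> \<open>An element of \<open>h\<close> has weight 0, hence no coordinates at basis
      vectors of nonzero weight. Coordinates at basis vectors of weight 0 vanish on root vectors,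
      which now span everything.\<close>
    have "h = {0}"
    proof -
      have "H = 0" if H: "H \<in> h" for H
      proof -
        have "representation C H b = 0" if b: "b \<in> C" for b
        proof (cases "wt b = 0")
          case True
          have "subspace {x. representation C x b = 0}"
            using C(1,2) by (intro subspaceI)
              (simp_all add: representation_add representation_scale representation_zero)
          moreover have "representation C x b = 0" if "\<alpha> \<in> roots" "x \<in> root_space \<alpha>" for x \<alpha>
            using eigenbasis_representation_eq_0[OF C that(2)] that rootsD b True by metis
          ultimately have "n \<subseteq> {x. representation C x b = 0}"
            unfolding n_def by (intro span_minimal) auto
          thus ?thesis using nU by auto
        next
          case False
          thus ?thesis
            using eigenbasis_representation_eq_0[OF C, of H 0] H root_space_0 dual_0 b by auto
        qed
        hence "(\<Sum>b\<in>C. scale (representation C H b) b) = 0" by simp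
        thus "H = 0" using C by (simp add: sum_representation_eq)
      qed
      thus ?thesis using h_subspace subspace_0 by auto
    qed
    hence "H = 0" if "H \<in> h" for H using that by simp
    hence "bracket H x = scale (0 H) x" if "H \<in> h" for H x using that by fastforce
    hence "root_space 0 = UNIV" unfolding root_space_def by blast
    with root_space_0 have "x \<in> h" for x by blast
    with h_abelian nonabelian show False by blast
  qed
qed

section \<open>Duality between root spaces and coroot elements\<close>

lemma killing_nondegenerate:
  assumes "\<And>y. killing x y = 0"
  shows "x = 0"
proof -
  let ?Z = "{x. \<forall>y. killing x y = 0}"
  have "lie_ideal ?Z"
    unfolding lie_ideal_def
  proof (intro conjI allI ballI)
    show "subspace ?Z" by (rule subspaceI) (simp_all add: killing_add_left killing_scale_left)
    show "bracket u v \<in> ?Z" if "v \<in> ?Z" for u v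
      using that killing_invariant[of v u] bracket_anticommute[of u v] killing_scale_left[of "-1" "bracket v u"]
      by simp
  qed
  from simple[OF this] assms killing_nonzero show ?thesis by blast
qed

lemma killing_root_spaces:
  assumes x: "x \<in> root_space \<phi>" and y: "y \<in> root_space \<psi>" and H: "H \<in> h" "\<phi> H + \<psi> H \<noteq> 0"
  shows "killing x y = 0"
proof -
  have "killing (bracket x H) y = killing x (bracket H y)" by (rule killing_invariant)
  hence eq: "- \<phi> H * killing x y = \<psi> H * killing x y"
    using root_spaceD[OF x H(1)] root_spaceD[OF y H(1)] bracket_anticommute[of x H]
      killing_scale_left[of "- \<phi> H" x y] by (simp add: killing_scale_right)
  have "(\<phi> H + \<psi> H) * killing x y = 0" unfolding distrib_right eq[symmetric] by simp
  with H(2) show ?thesis by simp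
qed

lemma killing_h_nondegenerate:
  assumes t: "t \<in> h" and 0: "\<And>H. H \<in> h \<Longrightarrow> killing t H = 0"
  shows "t = 0"
proof (rule killing_nondegenerate)
  fix y
  have "y \<in> {y. killing t y = 0}"
  proof (rule root_decomposition)
    show "subspace {y. killing t y = 0}"
      by (rule subspaceI) (simp_all add: killing_add_right killing_scale_right)
    show "root_space \<alpha> \<subseteq> {y. killing t y = 0}" if \<alpha>: "\<alpha> \<in> roots" for \<alpha>
    proof
      fix y assume y: "y \<in> root_space \<alpha>"
      obtain H where "H \<in> h" "\<alpha> H \<noteq> 0" using dual_nonzero rootsD[OF \<alpha>] by blast
      with killing_root_spaces[OF _ y, of t 0 H] t root_space_0
      show "y \<in> {y. killing t y = 0}" by simp
    qed
  qed (use 0 in auto)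
  thus "killing t y = 0" by simp
qed

lemma ex_killing_pair:
  assumes \<alpha>: "\<alpha> \<in> roots" and e: "e \<in> root_space \<alpha>" "e \<noteq> 0"
  shows "\<exists>f\<in>root_space (- \<alpha>). killing e f \<noteq> 0"
proof (rule ccontr)
  assume no: "\<not> ?thesis"
  have "killing e y = 0" for y
  proof -
    have "y \<in> {y. killing e y = 0}"
    proof (rule root_decomposition)
      show "subspace {y. killing e y = 0}"
        by (rule subspaceI) (simp_all add: killing_add_right killing_scale_right)
      obtain H where "H \<in> h" "\<alpha> H \<noteq> 0" using dual_nonzero rootsD[OF \<alpha>] by blast
      thus "h \<subseteq> {y. killing e y = 0}"
        using killing_root_spaces[OF e(1), of _ 0 H] root_space_0 by auto
      show "root_space \<beta> \<subseteq> {y. killing e y = 0}" if \<beta>: "\<beta> \<in> roots" for \<beta>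
      proof (cases "\<beta> = - \<alpha>")
        case True
        thus ?thesis using no by auto
      next
        case False
        hence "\<alpha> + \<beta> \<noteq> 0" by (metis add.commute eq_neg_iff_add_eq_0)
        with dual_add[OF rootsD(1)[OF \<alpha>] rootsD(1)[OF \<beta>]]
        obtain H where "H \<in> h" "(\<alpha> + \<beta>) H \<noteq> 0" using dual_nonzero by blast
        thus ?thesis using killing_root_spaces[OF e(1), of _ \<beta> H] by auto
      qed
    qed
    thus ?thesis by simp
  qed
  with killing_nondegenerate e show False by blast
qed

text \<open>Invariance gives \<open>killing (bracket e g) H' = \<alpha> H' * killing e g\<close>, so
  \<open>bracket e g\<close> is proportional to the Killing dual of \<open>\<alpha>\<close>. That
  the factor is real and positive is what makes the induced form real on the span of the roots and
  positive on roots.\<close>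

lemma ex_root_coroot:
  assumes \<alpha>: "\<alpha> \<in> roots"
  shows "\<exists>H\<in>h. \<exists>r>0. (\<forall>H'\<in>h. killing H H' = complex_of_real r * \<alpha> H') \<and> \<alpha> H = 2 \<and>
    (\<forall>\<beta>\<in>roots. \<exists>n :: int. \<beta> H = of_int n \<and> \<beta> - rscale (of_int n) \<alpha> \<in> roots)"
proof -
  obtain e where e: "e \<in> root_space \<alpha>" "e \<noteq> 0"
    using \<alpha> subspace_0[OF subspace_root_space] by (fastforce simp: roots_def)
  obtain f where f: "f \<in> root_space (- \<alpha>)" "killing e f \<noteq> 0" using ex_killing_pair[OF \<alpha> e] by blast
  have K: "killing (bracket e g) H' = \<alpha> H' * killing e g" if "g \<in> root_space (- \<alpha>)" "H' \<in> h" for g H'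
    using killing_invariant[of e g H'] root_spaceD[OF that] bracket_anticommute[of g H']
    by (simp add: killing_scale_right)
  have "\<alpha> (bracket e f) \<noteq> 0"
  proof
    assume "\<alpha> (bracket e f) = 0"
    hence ef: "bracket e f = 0" by (rule bracket_opposite_eq_0[OF \<alpha> e(1) f(1)])
    obtain H where "H \<in> h" "\<alpha> H \<noteq> 0" using dual_nonzero rootsD[OF \<alpha>] by blast
    with K[OF f(1)] f(2) ef show False by auto
  qed
  then obtain g where g: "g \<in> root_space (- \<alpha>)" "\<alpha> (bracket e g) = 2" "bracket e g \<in> h"
    using coroot_element[OF \<alpha> e(1) f(1)] by blast
  let ?H = "bracket e g"
  have int: "\<forall>\<beta>\<in>roots. \<exists>n :: int. \<beta> ?H = of_int n \<and> \<beta> - rscale (of_int n) \<alpha> \<in> roots"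
    using coroot_element_integral[OF \<alpha> e(1) g(1,2)] by blast
  have "?H \<noteq> 0" using g(2) dual_h(1)[OF rootsD(1)[OF \<alpha>] g(3), of 0] by auto
  then obtain r where r: "r > 0" "killing ?H ?H = complex_of_real r"
    using killing_integral_pos[OF g(3)] int by (metis Ints_of_int)
  \<comment> \<open>Evaluating at \<open>?H\<close> itself gives
    \<open>killing ?H ?H = 2 * killing e g\<close>.\<close>
  have eg: "killing e g = complex_of_real (r / 2)" using K[OF g(1,3)] g(2) r(2) by simp
  show ?thesis
  proof (intro bexI[OF _ g(3)] exI[of _ "r / 2"] conjI ballI)
    show "killing ?H H' = complex_of_real (r / 2) * \<alpha> H'" if "H' \<in> h" for H'
      using K[OF g(1) that] eg by simp
  qed (use r g int in auto)
qed

section \<open>The inner product on the real span of the roots\<close>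

lemma killing_dual_eqI:
  assumes "t \<in> h" "\<And>H. H \<in> h \<Longrightarrow> killing t H = \<phi> H"
  shows "killing_dual \<phi> = t"
  unfolding killing_dual_def
proof (rule the_equality)
  fix s assume s: "s \<in> h \<and> (\<forall>H\<in>h. killing s H = \<phi> H)"
  have "s - t = 0"
  proof (rule killing_h_nondegenerate)
    show "s - t \<in> h" using s assms h_subspace by (simp add: subspace_diff)
    show "killing (s - t) H = 0" if "H \<in> h" for H
      using s assms(2) that killing_add_left[of "s - t" t H] by simp
  qed
  thus "s = t" by simp
qed (use assms in auto)

text \<open>Coroot elements, rescaled, represent the roots, and representability passes to real
  combinations.\<close>

lemma killing_dual_real_dual:
  assumes "\<phi> \<in> real_dual"
  shows "killing_dual \<phi> \<in> h \<and> (\<forall>H\<in>h. killing (killing_dual \<phi>) H = \<phi> H)"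
proof -
  have "\<exists>t\<in>h. \<forall>H\<in>h. killing t H = \<phi> H"
    using assms unfolding real_dual_def
  proof (induction rule: functional.span_induct)
    case base
    show ?case
    proof (rule functional.subspaceI)
      show "0 \<in> {\<phi>. \<exists>t\<in>h. \<forall>H\<in>h. killing t H = \<phi> H}"
        using subspace_0[OF h_subspace] by (auto intro!: bexI[of _ 0])
    next
      fix \<phi> \<psi> assume "\<phi> \<in> {\<phi>. \<exists>t\<in>h. \<forall>H\<in>h. killing t H = \<phi> H}" "\<psi> \<in> {\<phi>. \<exists>t\<in>h. \<forall>H\<in>h. killing t H = \<phi> H}"
      then obtain s t where "s \<in> h" "\<forall>H\<in>h. killing s H = \<phi> H" "t \<in> h" "\<forall>H\<in>h. killing t H = \<psi> H" by blast
      thus "\<phi> + \<psi> \<in> {\<phi>. \<exists>t\<in>h. \<forall>H\<in>h. killing t H = \<phi> H}"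
        using subspace_add[OF h_subspace] by (auto simp: killing_add_left intro!: bexI[of _ "s + t"])
    next
      fix r \<phi> assume "\<phi> \<in> {\<phi>. \<exists>t\<in>h. \<forall>H\<in>h. killing t H = \<phi> H}"
      then obtain s where "s \<in> h" "\<forall>H\<in>h. killing s H = \<phi> H" by blast
      thus "rscale r \<phi> \<in> {\<phi>. \<exists>t\<in>h. \<forall>H\<in>h. killing t H = \<phi> H}"
        using subspace_scale[OF h_subspace]
        by (auto simp: killing_scale_left rscale_def intro!: bexI[of _ "scale (of_real r) s"])
    qed
  next
    case (step \<alpha>)
    obtain H r where H: "H \<in> h" "r > 0" "\<forall>H'\<in>h. killing H H' = complex_of_real r * \<alpha> H'"
      using ex_root_coroot[OF step] by blast
    show ?case
      using H subspace_scale[OF h_subspace H(1)]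
      by (intro bexI[of _ "scale (inverse (of_real r)) H"]) (auto simp: killing_scale_left)
  qed
  then obtain t where t: "t \<in> h" "\<And>H. H \<in> h \<Longrightarrow> killing t H = \<phi> H" by blast
  with killing_dual_eqI[OF this] show ?thesis by simp
qed

lemma inner_dual_eq:
  assumes "\<phi> \<in> real_dual" "\<psi> \<in> real_dual"
  shows "inner_dual \<phi> \<psi> = Re (\<phi> (killing_dual \<psi>))"
  using killing_dual_real_dual[OF assms(1)] killing_dual_real_dual[OF assms(2)]
  by (simp add: inner_dual_def)

lemma inner_dual_commute: "inner_dual \<phi> \<psi> = inner_dual \<psi> \<phi>"
  by (simp add: inner_dual_def killing_commute)

lemma root_in_real_dual: "\<alpha> \<in> roots \<Longrightarrow> \<alpha> \<in> real_dual"
  unfolding real_dual_def by (rule functional.span_base)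

text \<open>The dual of \<open>\<alpha>\<close> is its coroot element \<open>H\<close> divided by
  \<open>r\<close>, so \<open>inner_dual \<alpha> \<alpha> = 2 / r\<close> and
  \<open>inner_dual \<beta> \<alpha> = n / r\<close> with \<open>n\<close> the value of
  \<open>\<beta>\<close> at \<open>H\<close>.\<close>

lemma inner_dual_root:
  assumes \<alpha>: "\<alpha> \<in> roots" and \<beta>: "\<beta> \<in> roots"
  shows "inner_dual \<alpha> \<alpha> > 0"
    "\<exists>n :: int. 2 * inner_dual \<beta> \<alpha> / inner_dual \<alpha> \<alpha> = of_int n \<and> \<beta> - rscale (of_int n) \<alpha> \<in> roots"
proof -
  obtain H r where H: "H \<in> h" "r > 0" "\<forall>H'\<in>h. killing H H' = complex_of_real r * \<alpha> H'" "\<alpha> H = 2"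
    and n: "\<exists>n :: int. \<beta> H = of_int n \<and> \<beta> - rscale (of_int n) \<alpha> \<in> roots"
    using ex_root_coroot[OF \<alpha>] \<beta> by blast
  have t: "killing_dual \<alpha> = scale (of_real (1 / r)) H"
    using H subspace_scale[OF h_subspace H(1)]
    by (intro killing_dual_eqI) (auto simp: killing_scale_left)
  have aa: "inner_dual \<alpha> \<alpha> = 2 / r"
    using dual_h(1)[OF rootsD(1)[OF \<alpha>] H(1)] H(4) t
    by (simp add: inner_dual_eq root_in_real_dual \<alpha>)
  with H show "inner_dual \<alpha> \<alpha> > 0" by simp
  from n obtain n :: int where n: "\<beta> H = of_int n" "\<beta> - rscale (of_int n) \<alpha> \<in> roots" by blast
  have "inner_dual \<beta> \<alpha> = of_int n / r"
    using dual_h(1)[OF rootsD(1)[OF \<beta>] H(1)] n(1) t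
    by (simp add: inner_dual_eq root_in_real_dual \<alpha> \<beta>)
  with aa H n(2) show "\<exists>n :: int. 2 * inner_dual \<beta> \<alpha> / inner_dual \<alpha> \<alpha> = of_int n \<and> \<beta> - rscale (of_int n) \<alpha> \<in> roots"
    by (intro exI[of _ n]) simp
qed

lemma inner_dual_add_left:
  assumes "\<phi> \<in> real_dual" "\<psi> \<in> real_dual" "\<xi> \<in> real_dual"
  shows "inner_dual (\<phi> + \<psi>) \<xi> = inner_dual \<phi> \<xi> + inner_dual \<psi> \<xi>"
proof -
  have "\<phi> + \<psi> \<in> real_dual" using assms functional.span_add unfolding real_dual_def by blast
  thus ?thesis using assms by (simp add: inner_dual_eq)
qed

lemma inner_dual_rscale_left:
  assumes "\<phi> \<in> real_dual" "\<psi> \<in> real_dual"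
  shows "inner_dual (rscale r \<phi>) \<psi> = r * inner_dual \<phi> \<psi>"
proof -
  have "rscale r \<phi> \<in> real_dual" using assms functional.span_scale unfolding real_dual_def by blast
  thus ?thesis using assms by (simp add: inner_dual_eq rscale_def)
qed

end

section \<open>Minuscule representations\<close>

context based_simple_lie_algebra
begin

lemma simple_systemD:
  "\<Delta> \<subseteq> roots" "functional.independent \<Delta>" "functional.span \<Delta> = real_dual"
  "\<beta> \<in> roots \<Longrightarrow> \<beta> \<in> positive_roots \<Delta> \<or> - \<beta> \<in> positive_roots \<Delta>"
  using simple_system by (auto simp: simple_system_def)

lemma root_basis: "root_basis rscale inner_dual roots \<Delta>"
proof
  show "2 * inner_dual \<beta> \<alpha> / inner_dual \<alpha> \<alpha> \<in> \<int>" if "\<alpha> \<in> roots" "\<beta> \<in> roots" for \<alpha> \<beta>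
    using inner_dual_root(2)[OF that] by (metis Ints_of_int)
  show "\<beta> - rscale (2 * inner_dual \<beta> \<alpha> / inner_dual \<alpha> \<alpha>) \<alpha> \<in> roots"
    if "\<alpha> \<in> roots" "\<beta> \<in> roots" for \<alpha> \<beta>
    using inner_dual_root(2)[OF that] by metis
  show "\<exists>k :: _ \<Rightarrow> nat. \<beta> = (\<Sum>\<alpha>\<in>\<Delta>. rscale (real (k \<alpha>)) \<alpha>) \<or> - \<beta> = (\<Sum>\<alpha>\<in>\<Delta>. rscale (real (k \<alpha>)) \<alpha>)"
    if "\<beta> \<in> roots" for \<beta>
    using simple_systemD(4)[OF that] unfolding positive_roots_def by blast
qed (use simple_systemD inner_dual_root inner_dual_add_left inner_dual_rscale_left inner_dual_commute
    in \<open>simp_all add: real_dual_def\<close>)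

lemma pair_coroot: "root_basis.pair rscale inner_dual \<mu> \<alpha> = inner_dual \<mu> (coroot \<alpha>)"
  by (simp add: root_basis.pair_def[OF root_basis] coroot_def)

lemma reflect_eq_reflection: "root_basis.reflect rscale inner_dual roots = reflection"
  by (intro ext) (simp add: root_basis.reflect_def[OF root_basis] reflection_def pair_coroot real_dual_def)

text \<open>The rewrites restate the abstract results in terms of \<open>real_dual\<close>,
  \<open>reflection\<close> and \<open>heap_order\<close>.\<close>

sublocale weyl: root_basis rscale inner_dual roots \<Delta>
  rewrites "functional.span roots = real_dual"
    and "root_basis.reflect rscale inner_dual roots = reflection"
    and "root_basis.heap_le rscale inner_dual roots = heap_order"
proof -
  show "functional.span roots = real_dual" by (simp add: real_dual_def)
  show "root_basis.heap_le rscale inner_dual roots = heap_order"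
    by (intro ext) (simp add: root_basis.heap_le_def[OF root_basis] heap_order_def
        root_basis.noncommuting_def[OF root_basis] reflect_eq_reflection)
qed (fact root_basis reflect_eq_reflection)+

lemma weyl_length_le: "set vs \<subseteq> \<Delta> \<Longrightarrow> weyl_length (fold reflection vs) \<le> length vs"
  unfolding weyl_length_def by (rule Least_le) blast

lemma reduced_word_reduced: "reduced_word ws w \<Longrightarrow> weyl.reduced ws"
  unfolding reduced_word_def weyl.reduced_def using weyl_length_le by metis

lemma weyl_length_attained:
  assumes "w \<in> weyl_group"
  shows "\<exists>ws. reduced_word ws w"
proof -
  from assms have "\<exists>n ws. set ws \<subseteq> \<Delta> \<and> length ws = n \<and> fold reflection ws = w"
    by (auto simp: weyl_group_def)
  from LeastI_ex[OF this] show ?thesis unfolding reduced_word_def weyl_length_def by blast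
qed

lemma longest_element_antidominant:
  assumes "longest_element w0" and lam: "dominant lam" and \<beta>: "\<beta> \<in> \<Delta>"
  shows "weyl.pair (w0 lam) \<beta> \<le> 0"
proof -
  obtain us where us: "reduced_word us w0"
    using assms weyl_length_attained by (auto simp: longest_element_def)
  have "length vs \<le> length us" if vs: "weyl.reduced vs" for vs
  proof -
    have vsW: "fold reflection vs \<in> weyl_group" using vs by (auto simp: weyl_group_def weyl.reduced_def)
    then obtain xs where xs: "reduced_word xs (fold reflection vs)" using weyl_length_attained by blast
    hence "length vs \<le> length xs" using weyl.reducedD[OF vs, of xs] by (simp add: reduced_word_def)
    also have "\<dots> \<le> length us"
      using xs us vsW assms(1) by (simp add: reduced_word_def longest_element_def)
    finally show ?thesis .
  qed
  hence "weyl.pair (fold reflection us lam) \<beta> \<le> 0"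
    using lam \<beta> reduced_word_reduced[OF us]
    by (intro weyl.longest_antidominant) (auto simp: dominant_def weight_lattice_def pair_coroot)
  thus ?thesis using us by (simp add: reduced_word_def)
qed

end

context lie_representation
begin

text \<open>A cover subtracts some simple root, the reflection a multiple of \<open>\<beta>\<close>.
  By independence the two simple roots coincide and the multiple is 1.\<close>

lemma weight_covers_reflection:
  assumes \<beta>: "\<beta> \<in> \<Delta>" and \<mu>: "\<mu> \<in> real_dual" and cov: "weight_covers \<mu> (reflection \<beta> \<mu>)"
  shows "weyl.pair \<mu> \<beta> = 1"
proof -
  obtain \<alpha> where \<alpha>: "\<alpha> \<in> \<Delta>" "reflection \<beta> \<mu> = \<mu> - \<alpha>" using cov by (auto simp: weight_covers_def)
  hence eq: "\<alpha> = rscale (weyl.pair \<mu> \<beta>) \<beta>" using \<mu> by (simp add: weyl.reflect_def)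
  have "\<beta> \<in> real_dual" using \<beta> simple_systemD(1) root_in_real_dual by blast
  hence "weyl.coef \<alpha> \<alpha> = weyl.pair \<mu> \<beta> * weyl.coef \<beta> \<alpha>"
    using eq weyl.coef_scale[of \<beta> "weyl.pair \<mu> \<beta>" \<alpha>] by simp
  thus ?thesis using \<alpha>(1) \<beta> weyl.coef_base by (auto split: if_splits)
qed

theorem heap_label_count_mesic:
  assumes min: "minuscule lam" and w0: "longest_element w0" and w: "minuscule_element lam w"
    and w_lam: "w lam = w0 lam" and red: "reduced_word ws w"
    and \<alpha>: "\<alpha> \<in> \<Delta>" and \<omega>: "fundamental_weight \<alpha> \<omega>"
  shows "mesic (order_ideals (heap ws) (heap_order ws)) (fon_der_flaass (heap ws) (heap_order ws))
    (\<lambda>I. real (card (I \<inter> heap_label_class ws \<alpha>))) (2 * inner_dual lam \<omega> / inner_dual \<alpha> \<alpha>)"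
proof -
  have dom: "dominant lam" using min by (simp add: minuscule_def)
  hence lam: "lam \<in> real_dual" by (simp add: dominant_def weight_lattice_def)
  obtain vs where vs: "reduced_word vs w"
    and cov: "\<And>j. j < length vs \<Longrightarrow>
      weight_covers (fold reflection (take j vs) lam) (fold reflection (take (Suc j) vs) lam)"
    using w by (auto simp: minuscule_element_def)
  have "weyl.pair (fold reflection (take j vs) lam) (vs ! j) = 1" if j: "j < length vs" for j
  proof (rule weight_covers_reflection)
    have sub: "set vs \<subseteq> \<Delta>" using vs by (simp add: reduced_word_def)
    thus "vs ! j \<in> \<Delta>" using j nth_mem by blast
    have "set (take j vs) \<subseteq> roots" using sub simple_systemD(1) set_take_subset by fast
    thus "fold reflection (take j vs) lam \<in> real_dual" using lam by (simp add: weyl.act_in_E)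
    show "weight_covers (fold reflection (take j vs) lam) (reflection (vs ! j) (fold reflection (take j vs) lam))"
      using cov[OF j] j by (simp add: take_Suc_conv_app_nth)
  qed
  \<comment> \<open>The word \<open>vs\<close> witnessing the saturated chain may differ from
    \<open>ws\<close>; equality of inversions carries the condition over.\<close>
  hence chain: "weyl.pair (fold reflection (take j ws) lam) (ws ! j) = 1" if "j < length ws" for j
    using vs red lam that reduced_word_reduced
    by (intro weyl.minuscule_chain_reduced[of ws vs]) (auto simp: reduced_word_def)
  show ?thesis
  proof (rule weyl.label_class_mesic[OF _ lam _ _ chain _ \<alpha>])
    show "set ws \<subseteq> \<Delta>" using red by (simp add: reduced_word_def)
    show "weyl.pair (fold reflection ws lam) \<beta> \<le> 0" if "\<beta> \<in> \<Delta>" for \<beta>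
      using longest_element_antidominant[OF w0 dom that] red w_lam by (simp add: reduced_word_def)
  qed (use dom \<omega> in \<open>auto simp: dominant_def weight_lattice_def fundamental_weight_def pair_coroot\<close>)
qed

end

theorem theorem1p2:
  fixes scale :: "complex \<Rightarrow> 'g::ab_group_add \<Rightarrow> 'g"
    and Basis :: "'g set"
    and scaleV :: "complex \<Rightarrow> 'v::ab_group_add \<Rightarrow> 'v"
    and BasisV :: "'v set"
    and bracket :: "'g \<Rightarrow> 'g \<Rightarrow> 'g"
    and \<rho> :: "'g \<Rightarrow> 'v \<Rightarrow> 'v"
    and h :: "'g set" and \<Delta> :: "('g \<Rightarrow> complex) set"
    and lam \<alpha> \<omega> :: "'g \<Rightarrow> complex"
    and w w0 :: "('g \<Rightarrow> complex) \<Rightarrow> 'g \<Rightarrow> complex"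
    and ws :: "('g \<Rightarrow> complex) list"
  assumes rep: "lie_representation scale Basis bracket h \<Delta> scaleV BasisV \<rho>"
    and min: "lie_representation.minuscule scale Basis bracket h \<Delta> scaleV \<rho> lam"
    and w0: "based_simple_lie_algebra.longest_element scale Basis bracket h \<Delta> w0"
    and w: "lie_representation.minuscule_element scale Basis bracket h \<Delta> scaleV \<rho> lam w"
    and w_lam: "w lam = w0 lam"
    and red: "based_simple_lie_algebra.reduced_word scale Basis bracket h \<Delta> ws w"
    and alpha: "\<alpha> \<in> \<Delta>"
    and omega: "based_simple_lie_algebra.fundamental_weight scale Basis bracket h \<Delta> \<alpha> \<omega>"
  shows "mesic
    (order_ideals (heap ws) (based_simple_lie_algebra.heap_order scale Basis bracket h ws))
    (fon_der_flaass (heap ws) (based_simple_lie_algebra.heap_order scale Basis bracket h ws))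
    (\<lambda>I. real (card (I \<inter> heap_label_class ws \<alpha>)))
    (2 * simple_lie_algebra_with_cartan.inner_dual scale Basis bracket h lam \<omega> /
       simple_lie_algebra_with_cartan.inner_dual scale Basis bracket h \<alpha> \<alpha>)"
proof -
  interpret lie_representation scale Basis bracket h \<Delta> scaleV BasisV \<rho> by (rule rep)
  show ?thesis by (rule heap_label_count_mesic[OF min w0 w w_lam red alpha omega])
qed

end
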